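(* Let $n\ge1$. Consider the following Riemann–Hilbert problem for a $2\times2$ complex matrix valued function $Y$: (1) $Y(z)$ is analytic in $\{z:|z|>1\}\cup\{z:|z|<1\}$; (2) for $z\in\Sigma$, where $\Sigma$ is the unit circle oriented counter-clockwise and $+$ (resp. $-$) denotes the boundary value from the left-hand side, i.e. the interior (resp. right-hand side, i.e. the exterior), $$Y_+(z)=Y_-(z)\begin{pmatrix}1&w(z)/z\\0&1\end{pmatrix};$$ (3) as $z\to\infty$, $$Y(z)=\left(\mathbb I+\mathrm O(z^{-1})\right)\begin{pmatrix}z^n&\mathrm O(z^{-2})\\ \mathrm O(z^n)&-z^{-1}\end{pmatrix};$$ (4) as $z\to0$, $$Y(z)=\left(\mathbb I+\mathrm O(z)\right)\begin{pmatrix}\mathrm O(1)&\mathrm O(z^{n-1})\\ \mathrm O(1)&\mathrm O(z^n)\end{pmatrix}.$$ Then the unique solution to this Riemann–Hilbert problem is $$Y(z)=\begin{pmatrix}\dfrac{\phi_n(z)}{\kappa_n}&\dfrac{\epsilon_n(z)}{2\kappa_nz}\\[6pt]\kappa_n\phi^*_n(z)&-\dfrac{\kappa_n\epsilon^*_n(z)}{2z}\end{pmatrix}.$$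
   Context: Let $\mathbb T=\{\zeta\in\mathbb C:|\zeta|=1\}$, $\zeta=e^{i\theta}$, $\theta\in(-\pi,\pi]$. The weight $w$ is a complex (not necessarily real or positive) function, analytic in a cut complex plane, with $z^jw,z^jw'\in L^1(\mathbb T)$ for all $j\in\mathbb Z$ and with expansion $w(z)=\sum_{k\in\mathbb Z}w_kz^k$, $w_k=\int_{\mathbb T}\frac{d\zeta}{2\pi i\zeta}w(\zeta)\zeta^{-k}$, converging in an annulus containing $\mathbb T$. Assume $\det[w_{j-k}]_{0\le j,k\le n-1}\ne0$ for all $n\ge1$. The bi-orthonormal polynomials are $\phi_n(z)=\kappa_nz^n+\dots+\phi_n(0)$ and $\bar\phi_n(z)=\kappa_nz^n+\dots+\bar\phi_n(0)$, of degree $n$ with the same leading coefficient $\kappa_n\ne0$, satisfying $\int_{\mathbb T}\frac{d\zeta}{2\pi i\zeta}w(\zeta)\phi_m(\zeta)\bar\phi_n(\bar\zeta)=\delta_{m,n}$ with $\bar\zeta=\zeta^{-1}$ on $\mathbb T$; the bar on $\bar\phi_n$ is notation and does not denote complex conjugation. The reciprocal polynomial is $\phi^*_n(z)=z^n\bar\phi_n(1/z)$. For $n\ge1$ the associated functions, defined for $z\notin\mathbb T$, are $\epsilon_n(z)=\int_{\mathbb T}\frac{d\zeta}{2\pi i\zeta}\frac{\zeta+z}{\zeta-z}w(\zeta)\phi_n(\zeta)$ and $\epsilon^*_n(z)=-z^n\int_{\mathbb T}\frac{d\zeta}{2\pi i\zeta}\frac{\zeta+z}{\zeta-z}w(\zeta)\bar\phi_n(\bar\zeta)$.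 *)

theory Defs
  imports
    "Jordan_Normal_Form.Determinant"
    "HOL-Complex_Analysis.Complex_Analysis"
    "HOL-Library.Landau_Symbols"
begin

hide_const (open) Matrix.mat Determinant.det Matrix.vec
no_notation Matrix.vec_index (infixl "$" 100)

definition circle_int :: "(complex \<Rightarrow> complex) \<Rightarrow> complex" where
  "circle_int f = contour_integral (circlepath 0 1) (\<lambda>\<zeta>. f \<zeta> / (2 * of_real pi * \<i> * \<zeta>))"

definition fourier_coeff :: "(complex \<Rightarrow> complex) \<Rightarrow> int \<Rightarrow> complex" where
  "fourier_coeff w k = circle_int (\<lambda>\<zeta>. w \<zeta> * \<zeta> powi (- k))"

text \<open>
  The cut is only required to be a closed set without interior points, so that any system of
  branch cuts is covered. The bi-infinite expansion is over all integers; \<open>has_sum\<close> (absolute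
  convergence) is no restriction for a Laurent series on an open annulus.
\<close>
definition admissible_weight :: "(complex \<Rightarrow> complex) \<Rightarrow> bool" where
  "admissible_weight w \<longleftrightarrow>
     (\<exists>cut. closed cut \<and> interior cut = {} \<and> w holomorphic_on (- cut)) \<and>
     (\<forall>j::int. (\<lambda>\<theta>. cis \<theta> powi j * w (cis \<theta>)) absolutely_integrable_on {-pi..pi} \<and>
               (\<lambda>\<theta>. cis \<theta> powi j * deriv w (cis \<theta>)) absolutely_integrable_on {-pi..pi}) \<and>
     (\<exists>r R. 0 \<le> r \<and> r < 1 \<and> 1 < R \<and>
        (\<forall>z. r < norm z \<and> norm z < R \<longrightarrow>
           ((\<lambda>k::int. fourier_coeff w k * z powi k) has_sum w z) UNIV))"

definition toeplitz_det :: "(complex \<Rightarrow> complex) \<Rightarrow> nat \<Rightarrow> complex" where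
  "toeplitz_det w n =
     Determinant.det (Matrix.mat n n (\<lambda>(j, k). fourier_coeff w (int j - int k)))"

text \<open>
  \<open>\<phi>b\<close> is the second family of polynomials, unrelated to complex conjugation; on the unit circle
  the conjugate of \<open>\<zeta>\<close> is \<open>1 / \<zeta>\<close>.
\<close>
definition biorthonormal ::
  "(complex \<Rightarrow> complex) \<Rightarrow> (nat \<Rightarrow> complex) \<Rightarrow> (nat \<Rightarrow> complex poly) \<Rightarrow> (nat \<Rightarrow> complex poly) \<Rightarrow> bool" where
  "biorthonormal w \<kappa> \<phi> \<phi>b \<longleftrightarrow>
     (\<forall>n. \<kappa> n \<noteq> 0 \<and> degree (\<phi> n) = n \<and> lead_coeff (\<phi> n) = \<kappa> n \<and>
                       degree (\<phi>b n) = n \<and> lead_coeff (\<phi>b n) = \<kappa> n) \<and>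
     (\<forall>m n. circle_int (\<lambda>\<zeta>. w \<zeta> * poly (\<phi> m) \<zeta> * poly (\<phi>b n) (1 / \<zeta>)) =
              (if m = n then 1 else 0))"

text \<open>
  The reciprocal polynomial of \<open>\<phi>b n\<close> is \<^const>\<open>reflect_poly\<close>; as a polynomial it also has the right
  value at 0, where the expression \<open>z ^ n * poly (\<phi>b n) (1 / z)\<close> does not.
\<close>
lemma poly_reflect_poly_biorthonormal:
  assumes "biorthonormal w \<kappa> \<phi> \<phi>b" "z \<noteq> 0"
  shows "poly (reflect_poly (\<phi>b n)) z = z ^ n * poly (\<phi>b n) (1 / z)"
  using assms by (simp add: biorthonormal_def poly_reflect_poly_nz inverse_eq_divide)

definition assoc_eps :: "(complex \<Rightarrow> complex) \<Rightarrow> (nat \<Rightarrow> complex poly) \<Rightarrow> nat \<Rightarrow> complex \<Rightarrow> complex" where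
  "assoc_eps w \<phi> n z =
     circle_int (\<lambda>\<zeta>. (\<zeta> + z) / (\<zeta> - z) * w \<zeta> * poly (\<phi> n) \<zeta>)"

definition assoc_eps_star :: "(complex \<Rightarrow> complex) \<Rightarrow> (nat \<Rightarrow> complex poly) \<Rightarrow> nat \<Rightarrow> complex \<Rightarrow> complex" where
  "assoc_eps_star w \<phi>b n z =
     - (z ^ n) * circle_int (\<lambda>\<zeta>. (\<zeta> + z) / (\<zeta> - z) * w \<zeta> * poly (\<phi>b n) (1 / \<zeta>))"

definition matrix2 :: "complex \<Rightarrow> complex \<Rightarrow> complex \<Rightarrow> complex \<Rightarrow> complex^2^2" where
  "matrix2 a b c d = vector [vector [a, b], vector [c, d]]"

text \<open>
  Values on the unit circle are irrelevant. Boundary values are unrestricted limits from either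
  side at every point of the circle; they are then automatically continuous.
  The symbols \<open>O(..)\<close> stand for the existentially quantified functions \<open>E\<close>, \<open>a\<close>, \<open>b\<close>, \<open>c\<close>, \<open>d\<close>.
\<close>
definition RH_solution :: "(complex \<Rightarrow> complex) \<Rightarrow> nat \<Rightarrow> (complex \<Rightarrow> complex^2^2) \<Rightarrow> bool" where
  "RH_solution w n Y \<longleftrightarrow>
     (\<forall>i j. (\<lambda>z. Y z $ i $ j) holomorphic_on ({z. norm z > 1} \<union> {z. norm z < 1})) \<and>
     (\<forall>z. norm z = 1 \<longrightarrow>
        (\<exists>Y\<^sub>p Y\<^sub>m. (Y \<longlongrightarrow> Y\<^sub>p) (at z within {u. norm u < 1}) \<and>
                 (Y \<longlongrightarrow> Y\<^sub>m) (at z within {u. norm u > 1}) \<and>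
                 Y\<^sub>p = Y\<^sub>m ** matrix2 1 (w z / z) 0 1)) \<and>
     (\<exists>E b c. (\<forall>i j. (\<lambda>z. E z $ i $ j) \<in> O[at_infinity](\<lambda>z. 1 / z)) \<and>
        b \<in> O[at_infinity](\<lambda>z. 1 / z ^ 2) \<and> c \<in> O[at_infinity](\<lambda>z. z ^ n) \<and>
        (\<forall>\<^sub>F z in at_infinity.
           Y z = (mat 1 + E z) ** matrix2 (z ^ n) (b z) (c z) (- 1 / z))) \<and>
     (\<exists>E a b c d. (\<forall>i j. (\<lambda>z. E z $ i $ j) \<in> O[at 0](\<lambda>z. z)) \<and>
        a \<in> O[at 0](\<lambda>z. 1) \<and> b \<in> O[at 0](\<lambda>z. z ^ (n - 1)) \<and>
        c \<in> O[at 0](\<lambda>z. 1) \<and> d \<in> O[at 0](\<lambda>z. z ^ n) \<and>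
        (\<forall>\<^sub>F z in at 0. Y z = (mat 1 + E z) ** matrix2 (a z) (b z) (c z) (d z)))"

text \<open>
  The second column has a removable singularity at 0, where the quotients below evaluate to 0 in
  HOL; \<^const>\<open>remove_sings\<close> inserts the limit there. At all other points off the unit circle it
  changes nothing, the quotients being continuous there.
\<close>
definition RH_matrix ::
  "(complex \<Rightarrow> complex) \<Rightarrow> (nat \<Rightarrow> complex) \<Rightarrow> (nat \<Rightarrow> complex poly) \<Rightarrow> (nat \<Rightarrow> complex poly) \<Rightarrow>
   nat \<Rightarrow> complex \<Rightarrow> complex^2^2" where
  "RH_matrix w \<kappa> \<phi> \<phi>b n z =
     matrix2
       (poly (\<phi> n) z / \<kappa> n)
       (remove_sings (\<lambda>u. assoc_eps w \<phi> n u / (2 * \<kappa> n * u)) z)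
       (\<kappa> n * poly (reflect_poly (\<phi>b n)) z)
       (remove_sings (\<lambda>u. - (\<kappa> n * assoc_eps_star w \<phi>b n u / (2 * u))) z)"

end

theory Submission
  imports Defs
begin

text \<open>
  Let \<open>J\<close> be the jump matrix with rows \<open>(1, w z / z)\<close> and \<open>(0, 1)\<close>. Since \<open>det J = 1\<close>, for any
  two solutions \<open>X\<close> and \<open>Y\<close> the entries of \<open>Y * adj X\<close> take the same boundary values from both
  sides of the circle, so they extend to entire functions (\<open>entire_extension_across_unit_circle\<close>).
  The prescribed behaviour at \<open>\<infinity>\<close> and at \<open>0\<close> bounds each of them by a single power of \<open>z\<close> at both
  ends, and Liouville's theorem leaves only a multiple of that power (\<open>no_jump_eq_monomial\<close>). The
  outcome is \<open>Y * adj X = - z ^ (n - 1) * I\<close>. The choice \<open>Y = X\<close> gives \<open>det X = - z ^ (n - 1)\<close>, so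
  \<open>Y = X\<close> off the circle. In particular uniqueness (\<open>RH_solution_unique\<close>) depends on the
  problem alone and not on the polynomials.

  For existence, the second column of the matrix consists of Cauchy transforms of the first column
  times \<open>w s / s\<close>: the kernel \<open>(s + z) / (s - z)\<close> equals \<open>1 + 2 * z / (s - z)\<close>, and the integral of
  the constant part vanishes by bi-orthogonality. The weight is analytic in an annulus around the
  circle, so the circle of integration may be moved outwards or inwards. The interior part of the
  transform therefore continues analytically past the circle, as does the exterior part, and the
  difference of the two continuations is the density (\<open>cauchy_transform_boundary_values\<close>); this is
  the jump condition. The orders of vanishing at \<open>0\<close> and at \<open>\<infinity>\<close> come from the identity
  \<open>s / (s - z) = 1 + z / (s - z)\<close> under the integral: a factor \<open>s\<close> in the density can be traded
  for a factor \<open>z\<close> in front whenever the corresponding moment of the density is zero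
  (\<open>cauchy_transform_shift\<close>, \<open>cauchy_transform_shift_power\<close>). These moments are exactly the
  bi-orthogonality integrals (\<open>biorthonormal_moments\<close>); the single nonzero one, equal to
  \<open>1 / \<kappa> n\<close>, produces the entry \<open>-1 / z\<close> at infinity.
\<close>

(* The symbol $ denotes vector components only; without this, terms with several matrix entries
   have exponentially many parses. *)
no_notation fps_nth (infixl "$" 75)

section \<open>Functions without a jump across the unit circle\<close>

text \<open>
  Pointwise limits along \<open>A\<close> already suffice for a continuous extension: an estimate that holds on
  \<open>A\<close> near \<open>x\<close> passes to the limits taken at points near \<open>x\<close>.
\<close>

lemma continuous_on_extend_by_limits:
  fixes f :: "'a::metric_space \<Rightarrow> 'b::metric_space"
  assumes "open A" "continuous_on A f"
    and lim: "\<And>x. x \<notin> A \<Longrightarrow> x islimpt A \<and> (f \<longlongrightarrow> L x) (at x within A)"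
  shows "continuous_on UNIV (\<lambda>x. if x \<in> A then f x else L x)"
    (is "continuous_on UNIV ?g")
proof -
  have near: "\<exists>d>0. \<forall>y\<in>A. dist y x < d \<longrightarrow> dist (f y) (?g x) < e" if "e > 0" for x e
  proof (cases "x \<in> A")
    case True
    then have "isCont f x"
      using assms(1,2) continuous_on_eq_continuous_at by blast
    with True \<open>e > 0\<close> show ?thesis
      unfolding continuous_at_eps_delta by metis
  next
    case False
    with lim have "(f \<longlongrightarrow> L x) (at x within A)" by blast
    with False \<open>e > 0\<close> show ?thesis
      by (auto simp: Lim_within) metis
  qed
  have "isCont ?g x" for x
    unfolding continuous_at_eps_delta
  proof (intro allI impI)
    fix e :: real assume "e > 0"
    then obtain d where d: "d > 0" "\<And>y. y \<in> A \<Longrightarrow> dist y x < d \<Longrightarrow> dist (f y) (?g x) < e / 2"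
      using near[of "e / 2" x] by auto
    have "dist (?g y) (?g x) < e" if y: "dist y x < d" for y
    proof (cases "y \<in> A")
      case True
      with d(2)[of y] y \<open>e > 0\<close> show ?thesis by auto
    next
      case False
      \<comment> \<open>Values at points of \<open>A\<close> near \<open>y\<close> are within \<open>e / 2\<close> of \<open>?g x\<close>, hence so is their limit.\<close>
      have "((\<lambda>u. dist (f u) (?g x)) \<longlongrightarrow> dist (L y) (?g x)) (at y within A)"
        using lim[OF False] by (intro tendsto_intros) auto
      moreover have "\<forall>\<^sub>F u in at y within A. dist (f u) (?g x) \<le> e / 2"
      proof -
        have "\<forall>\<^sub>F u in at y within A. u \<in> ball x d \<and> u \<in> A"
          unfolding eventually_at_topological
          using y by (intro exI[of _ "ball x d"]) (auto simp: dist_commute)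
        then show ?thesis
          by eventually_elim (use d(2) in \<open>force simp: dist_commute\<close>)
      qed
      moreover have "at y within A \<noteq> bot"
        using lim[OF False] by (simp add: trivial_limit_within)
      ultimately have "dist (L y) (?g x) \<le> e / 2"
        using tendsto_upperbound by blast
      with False \<open>e > 0\<close> show ?thesis by simp
    qed
    with d(1) show "\<exists>d>0. \<forall>y. dist y x < d \<longrightarrow> dist (?g y) (?g x) < e" by blast
  qed
  then show ?thesis
    by (simp add: continuous_on_eq_continuous_at)
qed

lemma islimpt_unit_circle:
  fixes z :: complex
  assumes z: "norm z = 1"
  shows "z islimpt {u. norm u < 1}" "z islimpt {u. norm u > 1}"
proof -
  have "z islimpt ball 0 1"
    using z by (simp add: islimpt_ball)
  also have "ball 0 1 = {u::complex. norm u < 1}" by auto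
  finally show "z islimpt {u. norm u < 1}" .
  show "z islimpt {u. norm u > 1}"
    unfolding islimpt_approachable
  proof (intro allI impI bexI conjI)
    fix e :: real assume e: "e > 0"
    have eq: "of_real (1 + e / 2) * z - z = of_real (e / 2) * z"
      by (simp add: algebra_simps)
    then show "of_real (1 + e / 2) * z \<noteq> z"
      using e z by auto
    show "dist (of_real (1 + e / 2) * z) z < e"
      unfolding dist_norm eq norm_mult norm_of_real z using e by simp
    show "of_real (1 + e / 2) * z \<in> {u. norm u > 1}"
      using e z unfolding mem_Collect_eq norm_mult norm_of_real by simp
  qed
qed

text \<open>
  Equal boundary values glue \<open>f\<close> to a continuous function \<open>g\<close>. The exponential maps the imaginary
  axis to the circle and the half-planes to its two sides, so \<open>g \<circ> exp\<close> is continuous and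
  holomorphic off a line, hence entire; a local logarithm carries this back to \<open>g\<close>.
\<close>

lemma entire_extension_across_unit_circle:
  assumes hol: "f holomorphic_on ({z. norm z > 1} \<union> {z. norm z < 1})"
    and lim: "\<And>z. norm z = 1 \<Longrightarrow>
      \<exists>l. (f \<longlongrightarrow> l) (at z within {u. norm u < 1}) \<and> (f \<longlongrightarrow> l) (at z within {u. norm u > 1})"
  obtains g where "g holomorphic_on UNIV" "\<And>z. norm z \<noteq> 1 \<Longrightarrow> g z = f z"
proof -
  define A where "A = {z::complex. norm z > 1} \<union> {z. norm z < 1}"
  have opA: "open A"
    unfolding A_def by (intro open_Un open_Collect_less continuous_intros)
  have A_iff: "z \<in> A \<longleftrightarrow> norm z \<noteq> 1" for z
    by (auto simp: A_def)
  from lim obtain L where L: "\<And>z. norm z = 1 \<Longrightarrow> (f \<longlongrightarrow> L z) (at z within {u. norm u < 1})"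
      "\<And>z. norm z = 1 \<Longrightarrow> (f \<longlongrightarrow> L z) (at z within {u. norm u > 1})"
    by metis
  define g where "g = (\<lambda>z. if z \<in> A then f z else L z)"
  have contg: "continuous_on UNIV g"
    unfolding g_def
  proof (rule continuous_on_extend_by_limits[OF opA])
    show "continuous_on A f"
      using hol by (simp add: A_def holomorphic_on_imp_continuous_on)
    fix x assume "x \<notin> A"
    then have x: "norm x = 1" by (simp add: A_iff)
    then show "x islimpt A \<and> (f \<longlongrightarrow> L x) (at x within A)"
      using L[OF x] islimpt_unit_circle[OF x]
      unfolding A_def by (auto simp: Lim_within_Un islimpt_Un)
  qed
  have holA: "g holomorphic_on A"
    using hol unfolding A_def[symmetric] by (rule holomorphic_transform) (simp add: g_def)
  have entire_exp: "(\<lambda>u. g (exp u)) holomorphic_on UNIV"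
  proof (rule holomorphic_on_paste_across_line[of UNIV 1 _ 0])
    show "(\<lambda>u. g (exp u)) holomorphic_on UNIV \<inter> {z. 1 \<bullet> z < 0}"
      by (rule holomorphic_on_compose_gen[of exp _ g A, unfolded o_def])
         (auto intro!: holomorphic_intros holA simp: A_iff inner_complex_def)
    show "(\<lambda>u. g (exp u)) holomorphic_on UNIV \<inter> {z. 0 < 1 \<bullet> z}"
      by (rule holomorphic_on_compose_gen[of exp _ g A, unfolded o_def])
         (auto intro!: holomorphic_intros holA simp: A_iff inner_complex_def)
    show "continuous_on UNIV (\<lambda>u. g (exp u))"
      by (intro continuous_on_compose2[OF contg] continuous_intros) auto
  qed auto
  have "g field_differentiable at z" for z
  proof (cases "z \<in> A")
    case True
    with holA opA show ?thesis
      using holomorphic_on_imp_differentiable_at by blast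
  next
    case False
    then have z: "z \<noteq> 0" by (auto simp: A_iff)
    \<comment> \<open>Near a point of the circle, \<open>g\<close> is the entire function \<open>g \<circ> exp\<close> after a branch of the logarithm.\<close>
    define U where "U = {u. u / z \<notin> \<real>\<^sub>\<le>\<^sub>0}"
    have "U = (\<lambda>u. u / z) -` (- \<real>\<^sub>\<le>\<^sub>0)" by (auto simp: U_def)
    moreover have "open ((\<lambda>u. u / z) -` (- \<real>\<^sub>\<le>\<^sub>0 :: complex set))"
      by (intro open_vimage) (auto intro!: continuous_intros simp: z)
    ultimately have "open U" by simp
    have "z \<in> U" by (auto simp: U_def z)
    have holU: "(\<lambda>u. g (exp (Ln (u / z) + Ln z))) holomorphic_on U"
      by (rule holomorphic_on_compose_gen[of _ _ "\<lambda>u. g (exp u)" UNIV, unfolded o_def])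
         (auto intro!: holomorphic_intros entire_exp simp: U_def z)
    have "exp (Ln (u / z) + Ln z) = u" if "u \<in> U" for u
    proof -
      from that have "u \<noteq> 0" by (auto simp: U_def)
      with z show ?thesis by (simp add: exp_add)
    qed
    with holU have "g holomorphic_on U"
      by (metis (no_types, lifting) holomorphic_transform)
    with \<open>open U\<close> \<open>z \<in> U\<close> show ?thesis
      using holomorphic_on_imp_differentiable_at by blast
  qed
  then have "g holomorphic_on UNIV"
    by (simp add: holomorphic_on_def)
  moreover have "g z = f z" if "norm z \<noteq> 1" for z
    using that by (simp add: g_def A_iff)
  ultimately show ?thesis by (rule that)
qed

text \<open>
  Division of the entire extension by \<open>z ^ m\<close> leaves a removable singularity at \<open>0\<close> and a finite
  limit at infinity, so the quotient is constant.
\<close>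

lemma no_jump_eq_monomial:
  assumes hol: "f holomorphic_on ({z. norm z > 1} \<union> {z. norm z < 1})"
    and lim: "\<And>z. norm z = 1 \<Longrightarrow>
      \<exists>l. (f \<longlongrightarrow> l) (at z within {u. norm u < 1}) \<and> (f \<longlongrightarrow> l) (at z within {u. norm u > 1})"
    and inf: "((\<lambda>z. f z / z ^ m) \<longlongrightarrow> c) at_infinity"
    and zero: "f \<in> O[at 0](\<lambda>z. z ^ m)"
    and z: "norm z \<noteq> 1" "z \<noteq> 0"
  shows "f z = c * z ^ m"
proof -
  obtain g where g: "g holomorphic_on UNIV" "\<And>z. norm z \<noteq> 1 \<Longrightarrow> g z = f z"
    using entire_extension_across_unit_circle[OF hol lim] by blast
  have ev0: "\<forall>\<^sub>F u in at 0. norm u \<noteq> 1 \<and> u \<noteq> (0::complex)"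
    unfolding eventually_at by (rule exI[of _ 1]) (auto simp: dist_norm)
  have evinf: "\<forall>\<^sub>F u in at_infinity. norm u \<noteq> 1 \<and> u \<noteq> (0::complex)"
    unfolding eventually_at_infinity by (rule exI[of _ 2]) auto
  have "(\<lambda>u. g u / u ^ m) \<in> O[at 0](\<lambda>_. 1)"
  proof -
    have "g \<in> O[at 0](\<lambda>z. z ^ m)"
      using zero by (rule landau_o.big.in_cong[THEN iffD2, rotated])
        (use ev0 in eventually_elim, simp add: g(2))
    then have "(\<lambda>u. g u / u ^ m) \<in> O[at 0](\<lambda>u. u ^ m / u ^ m)"
      by (rule landau_o.big.divide_right[rotated])
        (use ev0 in eventually_elim, simp)
    also have "(\<lambda>u::complex. u ^ m / u ^ m) \<in> \<Theta>[at 0](\<lambda>_. 1)"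
      by (rule bigthetaI_cong) (use ev0 in eventually_elim, simp)
    finally show ?thesis .
  qed
  moreover have "(\<lambda>u. g u / u ^ m) holomorphic_on UNIV - {0}"
    by (intro holomorphic_intros holomorphic_on_subset[OF g(1)]) auto
  ultimately obtain q where q: "q holomorphic_on UNIV" "\<And>u. u \<noteq> 0 \<Longrightarrow> q u = g u / u ^ m"
    using holomorphic_on_extend[of "\<lambda>u. g u / u ^ m" UNIV 0] by auto
  have "(q \<longlongrightarrow> c) at_infinity"
    using inf by (rule Lim_transform_eventually)
      (use evinf in eventually_elim, simp add: g(2) q(2))
  with q(1) have "q z = c" by (rule Liouville_weak)
  with q(2)[of z] g(2)[of z] z show ?thesis by (simp add: field_simps)
qed

section \<open>Order estimates\<close>

lemma bigo_inverse_tendsto_0: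
  fixes f :: "complex \<Rightarrow> complex"
  assumes "f \<in> O[at_infinity](\<lambda>z. 1 / z)"
  shows "(f \<longlongrightarrow> 0) at_infinity"
proof -
  have "((\<lambda>z::complex. 1 / z) \<longlongrightarrow> 0) at_infinity"
    by (rule tendsto_divide_0[OF tendsto_const filterlim_ident])
  then have "(\<lambda>z::complex. 1 / z) \<in> o[at_infinity](\<lambda>_. 1)"
    by (intro smalloI_tendsto) auto
  with assms have "f \<in> o[at_infinity](\<lambda>_. 1)"
    by (rule landau_o.big_small_trans)
  then show ?thesis by (auto dest: smalloD_tendsto)
qed

lemma eventually_nonzero_at_infinity: "\<forall>\<^sub>F z in at_infinity. z \<noteq> (0::complex)"
  unfolding eventually_at_infinity by (rule exI[of _ 1]) auto

text \<open>
  The product rule in a form in which the resulting bound need only agree with the product of the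
  bounds near the filter, e.g. \<open>z * (1 / z ^ 2) = 1 / z\<close> away from \<open>0\<close>.
\<close>

lemma bigo_mult_eventually_eq:
  fixes f g :: "complex \<Rightarrow> complex"
  assumes "f \<in> O[F](f')" "g \<in> O[F](g')" "\<forall>\<^sub>F z in F. f' z * g' z = h z"
  shows "(\<lambda>z. f z * g z) \<in> O[F](h)"
  using landau_o.big.mult[OF assms(1,2)] landau_o.big.cong[OF assms(3)] by blast

lemma bigo_divide_power:
  fixes f :: "complex \<Rightarrow> complex"
  assumes "f \<in> O[at_infinity](g)" "\<forall>\<^sub>F z in at_infinity. g z / z ^ n = h z"
  shows "(\<lambda>z. f z / z ^ n) \<in> O[at_infinity](h)"
  using bigo_mult_eventually_eq[OF assms(1) landau_o.big_refl, of "\<lambda>z. 1 / z ^ n"] assms(2) by simp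

lemma holomorphic_bigo_1_at:
  assumes "f holomorphic_on A" "open A" "z \<in> A"
  shows "f \<in> O[at z](\<lambda>_. 1)"
proof (rule bigoI_tendsto)
  have "isCont f z"
    using assms by (intro field_differentiable_imp_continuous_at holomorphic_on_imp_differentiable_at)
  then show "((\<lambda>u. f u / 1) \<longlongrightarrow> f z) (at z)" by (simp add: isCont_def)
qed simp

lemma poly_bigo_at_infinity:
  fixes p :: "complex poly"
  assumes "degree p \<le> m"
  shows "poly p \<in> O[at_infinity](\<lambda>z. z ^ m)"
proof -
  have "(\<lambda>z::complex. z ^ i) \<in> O[at_infinity](\<lambda>z. z ^ m)" if "i \<le> m" for i
  proof (rule bigoI[of _ 1], unfold eventually_at_infinity, intro exI[of _ 1] allI impI)
    fix z :: complex assume "1 \<le> norm z"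
    with that show "norm (z ^ i) \<le> 1 * norm (z ^ m)"
      by (simp add: norm_power power_increasing)
  qed
  then have "(\<lambda>z. \<Sum>i\<le>degree p. coeff p i * z ^ i) \<in> O[at_infinity](\<lambda>z. z ^ m)"
    using assms by (intro big_sum_in_bigo) simp
  then show ?thesis unfolding poly_altdef[abs_def] .
qed

section \<open>The Riemann--Hilbert conditions entry by entry\<close>

lemma tendsto_matrix_iff:
  fixes Y :: "'a \<Rightarrow> complex^'n^'m"
  shows "(Y \<longlongrightarrow> M) F \<longleftrightarrow> (\<forall>i j. ((\<lambda>z. Y z $ i $ j) \<longlongrightarrow> M $ i $ j) F)"
proof
  assume "(Y \<longlongrightarrow> M) F"
  then show "\<forall>i j. ((\<lambda>z. Y z $ i $ j) \<longlongrightarrow> M $ i $ j) F"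
    by (intro allI tendsto_vec_nth)
next
  assume "\<forall>i j. ((\<lambda>z. Y z $ i $ j) \<longlongrightarrow> M $ i $ j) F"
  then show "(Y \<longlongrightarrow> M) F"
    by (intro vec_tendstoI) simp
qed

lemma matrix2_nth [simp]:
  "matrix2 a b c d $ 1 $ 1 = a" "matrix2 a b c d $ 1 $ 2 = b"
  "matrix2 a b c d $ 2 $ 1 = c" "matrix2 a b c d $ 2 $ 2 = d"
  by (simp_all add: matrix2_def)

lemma matrix_eq2_iff:
  "(A :: complex^2^2) = B \<longleftrightarrow>
     A $ 1 $ 1 = B $ 1 $ 1 \<and> A $ 1 $ 2 = B $ 1 $ 2 \<and> A $ 2 $ 1 = B $ 2 $ 1 \<and> A $ 2 $ 2 = B $ 2 $ 2"
  by (auto simp: vec_eq_iff forall_2)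

lemma matrix_mult2_nth:
  "((A :: complex^2^2) ** B) $ i $ j = A $ i $ 1 * B $ 1 $ j + A $ i $ 2 * B $ 2 $ j"
  by (simp add: matrix_matrix_mult_def sum_2)

lemma mat_1_nth [simp]:
  "(mat 1 :: complex^2^2) $ 1 $ 1 = 1" "(mat 1 :: complex^2^2) $ 1 $ 2 = 0"
  "(mat 1 :: complex^2^2) $ 2 $ 1 = 0" "(mat 1 :: complex^2^2) $ 2 $ 2 = 1"
  by (simp_all add: mat_def)

text \<open>
  The jump matrix is upper triangular, so the condition splits by rows, with the first column
  continuous across the circle and the second one jumping by \<open>v\<close> times the first.
\<close>

lemma RH_jump_iff:
  fixes Y :: "complex \<Rightarrow> complex^2^2"
  shows "(\<exists>Yp Ym. (Y \<longlongrightarrow> Yp) F \<and> (Y \<longlongrightarrow> Ym) G \<and> Yp = Ym ** matrix2 1 v 0 1) \<longleftrightarrow>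
     (\<forall>i. \<exists>a b. ((\<lambda>z. Y z $ i $ 1) \<longlongrightarrow> a) F \<and> ((\<lambda>z. Y z $ i $ 1) \<longlongrightarrow> a) G \<and>
                ((\<lambda>z. Y z $ i $ 2) \<longlongrightarrow> a * v + b) F \<and> ((\<lambda>z. Y z $ i $ 2) \<longlongrightarrow> b) G)"
    (is "?L \<longleftrightarrow> ?R")
proof
  assume ?L
  then obtain Yp Ym where "(Y \<longlongrightarrow> Yp) F" "(Y \<longlongrightarrow> Ym) G" "Yp = Ym ** matrix2 1 v 0 1" by blast
  then have lim: "((\<lambda>z. Y z $ i $ j) \<longlongrightarrow> (Ym ** matrix2 1 v 0 1) $ i $ j) F"
    "((\<lambda>z. Y z $ i $ j) \<longlongrightarrow> Ym $ i $ j) G" for i j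
    by (simp_all add: tendsto_matrix_iff)
  show ?R
  proof
    fix i
    show "\<exists>a b. ((\<lambda>z. Y z $ i $ 1) \<longlongrightarrow> a) F \<and> ((\<lambda>z. Y z $ i $ 1) \<longlongrightarrow> a) G \<and>
                ((\<lambda>z. Y z $ i $ 2) \<longlongrightarrow> a * v + b) F \<and> ((\<lambda>z. Y z $ i $ 2) \<longlongrightarrow> b) G"
      using lim[of i 1] lim[of i 2]
      by (intro exI[of _ "Ym $ i $ 1"] exI[of _ "Ym $ i $ 2"]) (simp add: matrix_mult2_nth)
  qed
next
  assume ?R
  then obtain a b where
    "\<And>i. ((\<lambda>z. Y z $ i $ 1) \<longlongrightarrow> a i) F \<and> ((\<lambda>z. Y z $ i $ 1) \<longlongrightarrow> a i) G \<and>
          ((\<lambda>z. Y z $ i $ 2) \<longlongrightarrow> a i * v + b i) F \<and> ((\<lambda>z. Y z $ i $ 2) \<longlongrightarrow> b i) G"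
    by metis
  then show ?L
    by (intro exI[of _ "matrix2 (a 1) (a 1 * v + b 1) (a 2) (a 2 * v + b 2)"]
              exI[of _ "matrix2 (a 1) (b 1) (a 2) (b 2)"])
       (auto simp: tendsto_matrix_iff matrix_mult2_nth matrix_eq2_iff forall_2)
qed

text \<open>
  The existentially quantified error terms are eliminated. For the converse one may take \<open>b = 0\<close>
  and for \<open>c\<close> the lower left entry itself; the identity
  \<open>Y = (1 + E) ** matrix2 (z ^ n) 0 c (- 1 / z)\<close> then determines \<open>E\<close>, with division
  by powers of \<open>z\<close> only.
\<close>

lemma RH_at_infinity_iff:
  fixes Y :: "complex \<Rightarrow> complex^2^2"
  shows "(\<exists>E b c. (\<forall>i j. (\<lambda>z. E z $ i $ j) \<in> O[at_infinity](\<lambda>z. 1 / z)) \<and>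
            b \<in> O[at_infinity](\<lambda>z. 1 / z ^ 2) \<and> c \<in> O[at_infinity](\<lambda>z. z ^ n) \<and>
            (\<forall>\<^sub>F z in at_infinity.
               Y z = (mat 1 + E z) ** matrix2 (z ^ n) (b z) (c z) (- 1 / z))) \<longleftrightarrow>
     (\<lambda>z. Y z $ 1 $ 1 / z ^ n - 1) \<in> O[at_infinity](\<lambda>z. 1 / z) \<and>
     (\<lambda>z. Y z $ 1 $ 2) \<in> O[at_infinity](\<lambda>z. 1 / z ^ 2) \<and>
     (\<lambda>z. Y z $ 2 $ 1) \<in> O[at_infinity](\<lambda>z. z ^ n) \<and>
     (\<lambda>z. - (z * Y z $ 2 $ 2) - 1) \<in> O[at_infinity](\<lambda>z. 1 / z)"
    (is "?L \<longleftrightarrow> ?A11 \<and> ?A12 \<and> ?A21 \<and> ?A22")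
proof
  assume ?L
  then obtain E b c where
    E: "\<And>i j. (\<lambda>z. E z $ i $ j) \<in> O[at_infinity](\<lambda>z. 1 / z)"
    and b: "b \<in> O[at_infinity](\<lambda>z. 1 / z ^ 2)" and c: "c \<in> O[at_infinity](\<lambda>z. z ^ n)"
    and Y: "\<forall>\<^sub>F z in at_infinity. Y z = (mat 1 + E z) ** matrix2 (z ^ n) (b z) (c z) (- 1 / z)"
    by blast
  note ev = eventually_conj[OF Y eventually_nonzero_at_infinity]
  have c': "(\<lambda>z. c z / z ^ n) \<in> O[at_infinity](\<lambda>_. 1)"
    by (rule bigo_divide_power[OF c]) (use eventually_nonzero_at_infinity in eventually_elim, simp)
  have b': "(\<lambda>z. b z * z) \<in> O[at_infinity](\<lambda>z. 1 / z)"
    by (rule bigo_mult_eventually_eq[OF b landau_o.big_refl])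
       (use eventually_nonzero_at_infinity in eventually_elim, simp add: power2_eq_square)
  have E1: "(\<lambda>z. E z $ i $ j) \<in> O[at_infinity](\<lambda>_. 1)" for i j
    by (rule bigoI_tendsto[where c = 0]) (use bigo_inverse_tendsto_0[OF E] in simp_all)
  have "(\<lambda>z. E z $ 1 $ 1 + E z $ 1 $ 2 * (c z / z ^ n)) \<in> O[at_infinity](\<lambda>z. 1 / z)"
    by (intro sum_in_bigo E bigo_mult_eventually_eq[OF E c']) simp
  moreover have "\<forall>\<^sub>F z in at_infinity.
      Y z $ 1 $ 1 / z ^ n - 1 = E z $ 1 $ 1 + E z $ 1 $ 2 * (c z / z ^ n)"
    using ev by eventually_elim (simp add: matrix_mult2_nth field_simps)
  ultimately have ?A11
    by (simp add: landau_o.big.in_cong)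
  have "(\<lambda>z. b z + E z $ 1 $ 1 * b z - E z $ 1 $ 2 * (1 / z)) \<in> O[at_infinity](\<lambda>z. 1 / z ^ 2)"
    by (intro sum_in_bigo b bigo_mult_eventually_eq[OF E1 b] bigo_mult_eventually_eq[OF E landau_o.big_refl])
       (auto simp: power2_eq_square)
  moreover have "\<forall>\<^sub>F z in at_infinity.
      Y z $ 1 $ 2 = b z + E z $ 1 $ 1 * b z - E z $ 1 $ 2 * (1 / z)"
    using ev by eventually_elim (simp add: matrix_mult2_nth field_simps)
  ultimately have ?A12
    by (simp add: landau_o.big.in_cong)
  have "(\<lambda>z. E z $ 2 $ 1 * z ^ n + (c z + E z $ 2 $ 2 * c z)) \<in> O[at_infinity](\<lambda>z. z ^ n)"
    by (intro sum_in_bigo c bigo_mult_eventually_eq[OF E1 c]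
          bigo_mult_eventually_eq[OF E1 landau_o.big_refl]) auto
  moreover have "\<forall>\<^sub>F z in at_infinity.
      Y z $ 2 $ 1 = E z $ 2 $ 1 * z ^ n + (c z + E z $ 2 $ 2 * c z)"
    using ev by eventually_elim (simp add: matrix_mult2_nth field_simps)
  ultimately have ?A21
    by (simp add: landau_o.big.in_cong)
  have "(\<lambda>z. E z $ 2 $ 2 - E z $ 2 $ 1 * (b z * z)) \<in> O[at_infinity](\<lambda>z. 1 / z)"
    by (intro sum_in_bigo E bigo_mult_eventually_eq[OF E1 b']) simp
  moreover have "\<forall>\<^sub>F z in at_infinity.
      - (z * Y z $ 2 $ 2) - 1 = E z $ 2 $ 2 - E z $ 2 $ 1 * (b z * z)"
    using ev by eventually_elim (simp add: matrix_mult2_nth field_simps)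
  ultimately have ?A22
    by (simp add: landau_o.big.in_cong)
  with \<open>?A11\<close> \<open>?A12\<close> \<open>?A21\<close> show "?A11 \<and> ?A12 \<and> ?A21 \<and> ?A22" by blast
next
  assume R: "?A11 \<and> ?A12 \<and> ?A21 \<and> ?A22"
  define e12 where "e12 = (\<lambda>z. - (Y z $ 1 $ 2 * z))"
  define e22 where "e22 = (\<lambda>z. - (z * Y z $ 2 $ 2) - 1)"
  define e11 where "e11 = (\<lambda>z. (Y z $ 1 $ 1 / z ^ n - 1) - e12 z * (Y z $ 2 $ 1 / z ^ n))"
  define e21 where "e21 = (\<lambda>z. - (e22 z * (Y z $ 2 $ 1 / z ^ n)))"
  have c': "(\<lambda>z. Y z $ 2 $ 1 / z ^ n) \<in> O[at_infinity](\<lambda>_. 1)"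
    by (rule bigo_divide_power[of _ "\<lambda>z. z ^ n"])
       (use R in blast, use eventually_nonzero_at_infinity in eventually_elim, simp)
  have "(\<lambda>z. Y z $ 1 $ 2 * z) \<in> O[at_infinity](\<lambda>z. 1 / z)"
    by (rule bigo_mult_eventually_eq[of _ _ "\<lambda>z. 1 / z ^ 2", OF _ landau_o.big_refl])
       (use R in blast, use eventually_nonzero_at_infinity in eventually_elim,
         simp add: power2_eq_square)
  then have e12: "e12 \<in> O[at_infinity](\<lambda>z. 1 / z)" by (simp add: e12_def)
  have e22: "e22 \<in> O[at_infinity](\<lambda>z. 1 / z)" using R by (simp add: e22_def)
  have e11: "e11 \<in> O[at_infinity](\<lambda>z. 1 / z)"
    unfolding e11_def
    by (rule sum_in_bigo(2), use R in blast, rule bigo_mult_eventually_eq[OF e12 c']) simp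
  have "(\<lambda>z. e22 z * (Y z $ 2 $ 1 / z ^ n)) \<in> O[at_infinity](\<lambda>z. 1 / z)"
    by (rule bigo_mult_eventually_eq[OF e22 c']) simp
  then have e21: "e21 \<in> O[at_infinity](\<lambda>z. 1 / z)"
    unfolding e21_def by (simp only: landau_o.big.uminus_in_iff)
  show ?L
  proof (rule exI[of _ "\<lambda>z. matrix2 (e11 z) (e12 z) (e21 z) (e22 z)"], rule exI[of _ "\<lambda>_. 0"],
          rule exI[of _ "\<lambda>z. Y z $ 2 $ 1"], intro conjI)
    show "\<forall>i j. (\<lambda>z. matrix2 (e11 z) (e12 z) (e21 z) (e22 z) $ i $ j) \<in> O[at_infinity](\<lambda>z. 1 / z)"
      using e11 e12 e21 e22 by (simp add: forall_2)
    show "\<forall>\<^sub>F z in at_infinity. Y z = (mat 1 + matrix2 (e11 z) (e12 z) (e21 z) (e22 z)) **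
            matrix2 (z ^ n) 0 (Y z $ 2 $ 1) (- 1 / z)"
      using eventually_nonzero_at_infinity
      by eventually_elim
         (simp add: matrix_eq2_iff matrix_mult2_nth e11_def e12_def e21_def e22_def field_simps)
  qed (use R in auto)
qed

text \<open>
  Multiplication by \<open>1 + O(z)\<close> only adds terms of at least the prescribed orders of vanishing, so
  the prefactor can be dropped.
\<close>

lemma RH_at_zero_iff:
  fixes Y :: "complex \<Rightarrow> complex^2^2"
  assumes "n \<ge> 1"
  shows "(\<exists>E a b c d. (\<forall>i j. (\<lambda>z. E z $ i $ j) \<in> O[at 0](\<lambda>z. z)) \<and>
        a \<in> O[at 0](\<lambda>z. 1) \<and> b \<in> O[at 0](\<lambda>z. z ^ (n - 1)) \<and>
        c \<in> O[at 0](\<lambda>z. 1) \<and> d \<in> O[at 0](\<lambda>z. z ^ n) \<and>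
        (\<forall>\<^sub>F z in at 0. Y z = (mat 1 + E z) ** matrix2 (a z) (b z) (c z) (d z))) \<longleftrightarrow>
     (\<lambda>z. Y z $ 1 $ 1) \<in> O[at 0](\<lambda>_. 1) \<and> (\<lambda>z. Y z $ 1 $ 2) \<in> O[at 0](\<lambda>z. z ^ (n - 1)) \<and>
     (\<lambda>z. Y z $ 2 $ 1) \<in> O[at 0](\<lambda>_. 1) \<and> (\<lambda>z. Y z $ 2 $ 2) \<in> O[at 0](\<lambda>z. z ^ n)"
    (is "?L \<longleftrightarrow> ?A11 \<and> ?A12 \<and> ?A21 \<and> ?A22")
proof
  assume ?L
  then obtain E a b c d where
    E: "\<And>i j. (\<lambda>z. E z $ i $ j) \<in> O[at 0](\<lambda>z. z)"
    and a: "a \<in> O[at 0](\<lambda>z. 1)" and b: "b \<in> O[at 0](\<lambda>z. z ^ (n - 1))"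
    and c: "c \<in> O[at 0](\<lambda>z. 1)" and d: "d \<in> O[at 0](\<lambda>z. z ^ n)"
    and Y: "\<forall>\<^sub>F z in at 0. Y z = (mat 1 + E z) ** matrix2 (a z) (b z) (c z) (d z)"
    by blast
  have id1: "(\<lambda>z::complex. z) \<in> O[at 0](\<lambda>_. 1)"
    by (rule bigoI_tendsto[of _ _ 0]) (auto intro!: tendsto_eq_intros)
  have E1: "(\<lambda>z. E z $ i $ j) \<in> O[at 0](\<lambda>_. 1)" for i j
    using E id1 by (rule landau_o.big_trans)
  have d': "d \<in> O[at 0](\<lambda>z. z ^ (n - 1))"
  proof -
    have "(\<lambda>z::complex. z * z ^ (n - 1)) \<in> O[at 0](\<lambda>z. z ^ (n - 1))"
      by (rule bigo_mult_eventually_eq[OF id1 landau_o.big_refl]) simp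
    with assms have "(\<lambda>z::complex. z ^ n) \<in> O[at 0](\<lambda>z. z ^ (n - 1))"
      by (simp flip: power_Suc)
    with d show ?thesis by (rule landau_o.big_trans)
  qed
  have "(\<lambda>z. a z + E z $ 1 $ 1 * a z + E z $ 1 $ 2 * c z) \<in> O[at 0](\<lambda>_. 1)"
    "(\<lambda>z. c z + E z $ 2 $ 1 * a z + E z $ 2 $ 2 * c z) \<in> O[at 0](\<lambda>_. 1)"
    "(\<lambda>z. b z + E z $ 1 $ 1 * b z + E z $ 1 $ 2 * d z) \<in> O[at 0](\<lambda>z. z ^ (n - 1))"
    by (intro sum_in_bigo a b c d' bigo_mult_eventually_eq[OF E1 a]
        bigo_mult_eventually_eq[OF E1 b] bigo_mult_eventually_eq[OF E1 c]
        bigo_mult_eventually_eq[OF E1 d']; simp)+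
  moreover have "(\<lambda>z. d z + E z $ 2 $ 1 * b z + E z $ 2 $ 2 * d z) \<in> O[at 0](\<lambda>z. z ^ n)"
    using assms
    by (intro sum_in_bigo d bigo_mult_eventually_eq[OF E b] bigo_mult_eventually_eq[OF E1 d];
        simp flip: power_Suc)
  moreover have
    "\<forall>\<^sub>F z in at 0. Y z $ 1 $ 1 = a z + E z $ 1 $ 1 * a z + E z $ 1 $ 2 * c z"
    "\<forall>\<^sub>F z in at 0. Y z $ 2 $ 1 = c z + E z $ 2 $ 1 * a z + E z $ 2 $ 2 * c z"
    "\<forall>\<^sub>F z in at 0. Y z $ 1 $ 2 = b z + E z $ 1 $ 1 * b z + E z $ 1 $ 2 * d z"
    "\<forall>\<^sub>F z in at 0. Y z $ 2 $ 2 = d z + E z $ 2 $ 1 * b z + E z $ 2 $ 2 * d z"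
    by (use Y in eventually_elim, simp add: matrix_mult2_nth algebra_simps)+
  ultimately show "?A11 \<and> ?A12 \<and> ?A21 \<and> ?A22"
    by (simp add: landau_o.big.in_cong)
next
  assume "?A11 \<and> ?A12 \<and> ?A21 \<and> ?A22"
  then show ?L
    by (rule_tac exI[of _ "\<lambda>_. 0"], rule_tac exI[of _ "\<lambda>z. Y z $ 1 $ 1"],
        rule_tac exI[of _ "\<lambda>z. Y z $ 1 $ 2"], rule_tac exI[of _ "\<lambda>z. Y z $ 2 $ 1"],
        rule_tac exI[of _ "\<lambda>z. Y z $ 2 $ 2"])
       (simp add: matrix_eq2_iff matrix_mult2_nth)
qed

lemma RH_solution_iff_entries:
  assumes "n \<ge> 1"
  shows "RH_solution w n Y \<longleftrightarrow>
     (\<forall>i j. (\<lambda>z. Y z $ i $ j) holomorphic_on ({z. norm z > 1} \<union> {z. norm z < 1})) \<and>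
     (\<forall>z. norm z = 1 \<longrightarrow> (\<forall>i. \<exists>a b.
        ((\<lambda>u. Y u $ i $ 1) \<longlongrightarrow> a) (at z within {u. norm u < 1}) \<and>
        ((\<lambda>u. Y u $ i $ 1) \<longlongrightarrow> a) (at z within {u. norm u > 1}) \<and>
        ((\<lambda>u. Y u $ i $ 2) \<longlongrightarrow> a * (w z / z) + b) (at z within {u. norm u < 1}) \<and>
        ((\<lambda>u. Y u $ i $ 2) \<longlongrightarrow> b) (at z within {u. norm u > 1}))) \<and>
     ((\<lambda>z. Y z $ 1 $ 1 / z ^ n - 1) \<in> O[at_infinity](\<lambda>z. 1 / z) \<and>
      (\<lambda>z. Y z $ 1 $ 2) \<in> O[at_infinity](\<lambda>z. 1 / z ^ 2) \<and>
      (\<lambda>z. Y z $ 2 $ 1) \<in> O[at_infinity](\<lambda>z. z ^ n) \<and>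
      (\<lambda>z. - (z * Y z $ 2 $ 2) - 1) \<in> O[at_infinity](\<lambda>z. 1 / z)) \<and>
     ((\<lambda>z. Y z $ 1 $ 1) \<in> O[at 0](\<lambda>_. 1) \<and> (\<lambda>z. Y z $ 1 $ 2) \<in> O[at 0](\<lambda>z. z ^ (n - 1)) \<and>
      (\<lambda>z. Y z $ 2 $ 1) \<in> O[at 0](\<lambda>_. 1) \<and> (\<lambda>z. Y z $ 2 $ 2) \<in> O[at 0](\<lambda>z. z ^ n))"
  unfolding RH_solution_def RH_jump_iff RH_at_infinity_iff RH_at_zero_iff[OF assms] ..

section \<open>Uniqueness\<close>

text \<open>
  These functions are, up to sign, the entries of \<open>Y * adj X\<close>. Crossing the circle multiplies the
  rows of \<open>X\<close> and \<open>Y\<close> by the same matrix of determinant \<open>1\<close>, and this preserves the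
  determinant formed from a row of \<open>Y\<close> and a row of \<open>X\<close>.
\<close>

lemma RH_solution_row_wedge_no_jump:
  fixes X Y :: "complex \<Rightarrow> complex^2^2" and i j :: 2
  assumes X: "RH_solution w n X" and Y: "RH_solution w n Y" and n: "n \<ge> 1"
  defines "f \<equiv> \<lambda>z. Y z $ i $ 1 * X z $ j $ 2 - Y z $ i $ 2 * X z $ j $ 1"
  shows "f holomorphic_on ({z. norm z > 1} \<union> {z. norm z < 1})"
    and "norm z = 1 \<Longrightarrow>
      \<exists>l. (f \<longlongrightarrow> l) (at z within {u. norm u < 1}) \<and> (f \<longlongrightarrow> l) (at z within {u. norm u > 1})"
proof -
  note Xs = X[unfolded RH_solution_iff_entries[OF n]]
  note Ys = Y[unfolded RH_solution_iff_entries[OF n]]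
  show "f holomorphic_on ({z. norm z > 1} \<union> {z. norm z < 1})"
    unfolding f_def by (intro holomorphic_on_diff holomorphic_on_mult) (use Xs Ys in blast)+
  assume z: "norm z = 1"
  obtain a b where ab:
    "((\<lambda>u. Y u $ i $ 1) \<longlongrightarrow> a) (at z within {u. norm u < 1})"
    "((\<lambda>u. Y u $ i $ 1) \<longlongrightarrow> a) (at z within {u. norm u > 1})"
    "((\<lambda>u. Y u $ i $ 2) \<longlongrightarrow> a * (w z / z) + b) (at z within {u. norm u < 1})"
    "((\<lambda>u. Y u $ i $ 2) \<longlongrightarrow> b) (at z within {u. norm u > 1})"
    using conjunct1[OF conjunct2[OF Ys], rule_format, OF z, of i] by blast
  obtain c d where cd:
    "((\<lambda>u. X u $ j $ 1) \<longlongrightarrow> c) (at z within {u. norm u < 1})"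
    "((\<lambda>u. X u $ j $ 1) \<longlongrightarrow> c) (at z within {u. norm u > 1})"
    "((\<lambda>u. X u $ j $ 2) \<longlongrightarrow> c * (w z / z) + d) (at z within {u. norm u < 1})"
    "((\<lambda>u. X u $ j $ 2) \<longlongrightarrow> d) (at z within {u. norm u > 1})"
    using conjunct1[OF conjunct2[OF Xs], rule_format, OF z, of j] by blast
  have "(f \<longlongrightarrow> a * (c * (w z / z) + d) - (a * (w z / z) + b) * c) (at z within {u. norm u < 1})"
    unfolding f_def by (intro tendsto_intros ab cd)
  also have "a * (c * (w z / z) + d) - (a * (w z / z) + b) * c = a * d - b * c"
    by (simp add: algebra_simps)
  finally have "(f \<longlongrightarrow> a * d - b * c) (at z within {u. norm u < 1})" .
  moreover have "(f \<longlongrightarrow> a * d - b * c) (at z within {u. norm u > 1})"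
    unfolding f_def by (intro tendsto_intros ab cd)
  ultimately show "\<exists>l. (f \<longlongrightarrow> l) (at z within {u. norm u < 1}) \<and>
                       (f \<longlongrightarrow> l) (at z within {u. norm u > 1})" by blast
qed

text \<open>
  Orders of growth at infinity for the three determinants: the leading terms \<open>z ^ n\<close> and \<open>-1 / z\<close>
  give \<open>- z ^ (n - 1)\<close> in the first, while all other products are of lower order. In the last one
  the comparison is with \<open>z ^ n\<close>, because both lower left entries may grow like \<open>z ^ n\<close>; here the
  faster decay \<open>O(z ^ n)\<close> of the lower right entries at \<open>0\<close> compensates.
\<close>

lemma RH_solution_row_wedge:
  fixes X Y :: "complex \<Rightarrow> complex^2^2"
  assumes X: "RH_solution w n X" and Y: "RH_solution w n Y" and n: "n \<ge> 1"
    and z: "norm z \<noteq> 1" "z \<noteq> 0"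
  shows "Y z $ 1 $ 1 * X z $ 2 $ 2 - Y z $ 1 $ 2 * X z $ 2 $ 1 = - (z ^ (n - 1))" (is ?W12)
    and "Y z $ 1 $ 1 * X z $ 1 $ 2 - Y z $ 1 $ 2 * X z $ 1 $ 1 = 0" (is ?W11)
    and "Y z $ 2 $ 1 * X z $ 2 $ 2 - Y z $ 2 $ 2 * X z $ 2 $ 1 = 0" (is ?W22)
proof -
  obtain m where m: "n = Suc m" using n by (cases n) auto
  note nz = eventually_nonzero_at_infinity
  have lim11: "((\<lambda>z. Z z $ 1 $ 1 / z ^ n) \<longlongrightarrow> 1) at_infinity"
    and lim22: "((\<lambda>z. z * Z z $ 2 $ 2) \<longlongrightarrow> -1) at_infinity"
    and bigo11: "(\<lambda>z. Z z $ 1 $ 1) \<in> O[at_infinity](\<lambda>z. z ^ n)"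
    and bigo12: "(\<lambda>z. Z z $ 1 $ 2) \<in> O[at_infinity](\<lambda>z. 1 / z ^ 2)"
    and bigo21: "(\<lambda>z. Z z $ 2 $ 1) \<in> O[at_infinity](\<lambda>z. z ^ n)"
    and bigo22: "(\<lambda>z. Z z $ 2 $ 2) \<in> O[at_infinity](\<lambda>z. 1 / z)"
    and zero: "(\<lambda>z. Z z $ 1 $ 1) \<in> O[at 0](\<lambda>_. 1)"
      "(\<lambda>z. Z z $ 1 $ 2) \<in> O[at 0](\<lambda>z. z ^ (n - 1))"
      "(\<lambda>z. Z z $ 2 $ 1) \<in> O[at 0](\<lambda>_. 1)" "(\<lambda>z. Z z $ 2 $ 2) \<in> O[at 0](\<lambda>z. z ^ n)"
      "(\<lambda>z. Z z $ 2 $ 2) \<in> O[at 0](\<lambda>z. z ^ (n - 1))"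
    if Z: "RH_solution w n Z" for Z :: "complex \<Rightarrow> complex^2^2"
  proof -
    note Zs = Z[unfolded RH_solution_iff_entries[OF n]]
    from Zs show "(\<lambda>z. Z z $ 1 $ 2) \<in> O[at_infinity](\<lambda>z. 1 / z ^ 2)"
      "(\<lambda>z. Z z $ 2 $ 1) \<in> O[at_infinity](\<lambda>z. z ^ n)"
      "(\<lambda>z. Z z $ 1 $ 1) \<in> O[at 0](\<lambda>_. 1)" "(\<lambda>z. Z z $ 1 $ 2) \<in> O[at 0](\<lambda>z. z ^ (n - 1))"
      "(\<lambda>z. Z z $ 2 $ 1) \<in> O[at 0](\<lambda>_. 1)" and z22: "(\<lambda>z. Z z $ 2 $ 2) \<in> O[at 0](\<lambda>z. z ^ n)"
      by blast+
    have "((\<lambda>z. (Z z $ 1 $ 1 / z ^ n - 1) + 1) \<longlongrightarrow> 0 + 1) at_infinity"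
      by (intro tendsto_intros bigo_inverse_tendsto_0) (use Zs in blast)
    then show lim: "((\<lambda>z. Z z $ 1 $ 1 / z ^ n) \<longlongrightarrow> 1) at_infinity" by simp
    show "(\<lambda>z. Z z $ 1 $ 1) \<in> O[at_infinity](\<lambda>z. z ^ n)"
      by (rule bigoI_tendsto[OF lim]) (use nz in eventually_elim, simp)
    have "((\<lambda>z. - ((- (z * Z z $ 2 $ 2) - 1) + 1)) \<longlongrightarrow> - (0 + 1)) at_infinity"
      by (intro tendsto_intros bigo_inverse_tendsto_0) (use Zs in blast)
    then show lim': "((\<lambda>z. z * Z z $ 2 $ 2) \<longlongrightarrow> -1) at_infinity" by simp
    show "(\<lambda>z. Z z $ 2 $ 2) \<in> O[at_infinity](\<lambda>z. 1 / z)"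
      by (rule bigoI_tendsto[of _ _ "-1"])
         (use lim' in \<open>simp add: mult.commute\<close>, use nz in eventually_elim, simp)
    have "(\<lambda>z::complex. z) \<in> O[at 0](\<lambda>_. 1)"
      by (rule bigoI_tendsto[of _ _ 0]) (auto intro!: tendsto_eq_intros)
    then have "(\<lambda>z::complex. z * z ^ (n - 1)) \<in> O[at 0](\<lambda>z. z ^ (n - 1))"
      by (rule bigo_mult_eventually_eq[OF _ landau_o.big_refl]) simp
    with n have "(\<lambda>z::complex. z ^ n) \<in> O[at 0](\<lambda>z. z ^ (n - 1))"
      by (simp flip: power_Suc)
    with z22 show "(\<lambda>z. Z z $ 2 $ 2) \<in> O[at 0](\<lambda>z. z ^ (n - 1))"
      by (rule landau_o.big_trans)
  qed
  have small: "((\<lambda>z. f z * g z / z ^ (n - 1)) \<longlongrightarrow> 0) at_infinity"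
    if "f \<in> O[at_infinity](\<lambda>z. z ^ n)" "g \<in> O[at_infinity](\<lambda>z. 1 / z ^ 2)"
    for f g :: "complex \<Rightarrow> complex"
    by (rule bigo_inverse_tendsto_0, rule bigo_divide_power, rule landau_o.big.mult[OF that])
       (use nz in eventually_elim, simp add: m power2_eq_square field_simps)
  have small': "((\<lambda>z. f z * g z / z ^ n) \<longlongrightarrow> 0) at_infinity"
    if "f \<in> O[at_infinity](\<lambda>z. z ^ n)" "g \<in> O[at_infinity](\<lambda>z. 1 / z)"
    for f g :: "complex \<Rightarrow> complex"
    by (rule bigo_inverse_tendsto_0, rule bigo_divide_power, rule landau_o.big.mult[OF that])
       (use nz in eventually_elim, simp)
  note zX = zero[OF X] and zY = zero[OF Y]
  have "Y z $ 1 $ 1 * X z $ 2 $ 2 - Y z $ 1 $ 2 * X z $ 2 $ 1 = - 1 * z ^ (n - 1)"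
  proof (rule no_jump_eq_monomial[OF RH_solution_row_wedge_no_jump[OF X Y n] _ _ z])
    have "((\<lambda>z. Y z $ 1 $ 1 / z ^ n * (z * X z $ 2 $ 2) - X z $ 2 $ 1 * Y z $ 1 $ 2 / z ^ (n - 1))
            \<longlongrightarrow> 1 * - 1 - 0) at_infinity"
      by (intro tendsto_intros small lim11 lim22 bigo21 bigo12 X Y)
    then have "((\<lambda>z. Y z $ 1 $ 1 / z ^ n * (z * X z $ 2 $ 2) - X z $ 2 $ 1 * Y z $ 1 $ 2 / z ^ (n - 1))
            \<longlongrightarrow> - 1) at_infinity" by simp
    then show "((\<lambda>z. (Y z $ 1 $ 1 * X z $ 2 $ 2 - Y z $ 1 $ 2 * X z $ 2 $ 1) / z ^ (n - 1)) \<longlongrightarrow> - 1) at_infinity"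
    proof (rule Lim_transform_eventually)
      have "a / u ^ n * (u * b) = a * b / u ^ (n - 1)" if "u \<noteq> 0" for a b u :: complex
        using that by (simp add: m)
      then show "\<forall>\<^sub>F z in at_infinity. Y z $ 1 $ 1 / z ^ n * (z * X z $ 2 $ 2) - X z $ 2 $ 1 * Y z $ 1 $ 2 / z ^ (n - 1) =
          (Y z $ 1 $ 1 * X z $ 2 $ 2 - Y z $ 1 $ 2 * X z $ 2 $ 1) / z ^ (n - 1)"
        using nz by (auto elim!: eventually_mono simp: diff_divide_distrib mult.commute)
    qed
    show "(\<lambda>z. Y z $ 1 $ 1 * X z $ 2 $ 2 - Y z $ 1 $ 2 * X z $ 2 $ 1) \<in> O[at 0](\<lambda>z. z ^ (n - 1))"
      by (intro sum_in_bigo bigo_mult_eventually_eq[OF zY(1) zX(5)] bigo_mult_eventually_eq[OF zY(2) zX(3)])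
         auto
  qed
  then show ?W12 by simp
  have "Y z $ 1 $ 1 * X z $ 1 $ 2 - Y z $ 1 $ 2 * X z $ 1 $ 1 = 0 * z ^ (n - 1)"
  proof (rule no_jump_eq_monomial[OF RH_solution_row_wedge_no_jump[OF X Y n] _ _ z])
    have "((\<lambda>z. Y z $ 1 $ 1 * X z $ 1 $ 2 / z ^ (n - 1) - X z $ 1 $ 1 * Y z $ 1 $ 2 / z ^ (n - 1))
            \<longlongrightarrow> 0 - 0) at_infinity"
      by (intro tendsto_intros small bigo11 bigo12 X Y)
    then show "((\<lambda>z. (Y z $ 1 $ 1 * X z $ 1 $ 2 - Y z $ 1 $ 2 * X z $ 1 $ 1) / z ^ (n - 1)) \<longlongrightarrow> 0) at_infinity"
      by (simp add: diff_divide_distrib mult.commute)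
    show "(\<lambda>z. Y z $ 1 $ 1 * X z $ 1 $ 2 - Y z $ 1 $ 2 * X z $ 1 $ 1) \<in> O[at 0](\<lambda>z. z ^ (n - 1))"
      by (intro sum_in_bigo bigo_mult_eventually_eq[OF zY(1) zX(2)] bigo_mult_eventually_eq[OF zY(2) zX(1)])
         auto
  qed
  then show ?W11 by simp
  have "Y z $ 2 $ 1 * X z $ 2 $ 2 - Y z $ 2 $ 2 * X z $ 2 $ 1 = 0 * z ^ n"
  proof (rule no_jump_eq_monomial[OF RH_solution_row_wedge_no_jump[OF X Y n] _ _ z])
    have "((\<lambda>z. Y z $ 2 $ 1 * X z $ 2 $ 2 / z ^ n - X z $ 2 $ 1 * Y z $ 2 $ 2 / z ^ n)
            \<longlongrightarrow> 0 - 0) at_infinity"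
      by (intro tendsto_intros small' bigo21 bigo22 X Y)
    then show "((\<lambda>z. (Y z $ 2 $ 1 * X z $ 2 $ 2 - Y z $ 2 $ 2 * X z $ 2 $ 1) / z ^ n) \<longlongrightarrow> 0) at_infinity"
      by (simp add: diff_divide_distrib mult.commute)
    show "(\<lambda>z. Y z $ 2 $ 1 * X z $ 2 $ 2 - Y z $ 2 $ 2 * X z $ 2 $ 1) \<in> O[at 0](\<lambda>z. z ^ n)"
      by (intro sum_in_bigo bigo_mult_eventually_eq[OF zY(3) zX(4)] bigo_mult_eventually_eq[OF zY(4) zX(3)])
         auto
  qed
  then show ?W22 by simp
qed

text \<open>
  A vector in the plane is determined by its determinants with two linearly independent vectors.
\<close>

lemma eq_if_wedge_eq:
  fixes p1 p2 q1 q2 x1 x2 y1 y2 :: complex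
  assumes "p1 * x2 - p2 * x1 = q1 * x2 - q2 * x1" "p1 * y2 - p2 * y1 = q1 * y2 - q2 * y1"
    and "x1 * y2 - x2 * y1 \<noteq> 0"
  shows "p1 = q1" "p2 = q2"
proof -
  have x: "(p1 - q1) * x2 = (p2 - q2) * x1" and y: "(p1 - q1) * y2 = (p2 - q2) * y1"
    using assms(1,2) by (simp_all add: algebra_simps)
  have "(p1 - q1) * (x1 * y2 - x2 * y1) = x1 * ((p1 - q1) * y2) - ((p1 - q1) * x2) * y1"
    by (simp add: algebra_simps)
  also have "\<dots> = 0"
    unfolding x y by simp
  finally have "(p1 - q1) * (x1 * y2 - x2 * y1) = 0" .
  moreover have "(p2 - q2) * (x1 * y2 - x2 * y1) = ((p2 - q2) * x1) * y2 - x2 * ((p2 - q2) * y1)"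
    by (simp add: algebra_simps)
  then have "(p2 - q2) * (x1 * y2 - x2 * y1) = 0"
    unfolding x[symmetric] y[symmetric] by simp
  ultimately show "p1 = q1" "p2 = q2" using assms(3) by auto
qed

text \<open>
  The rows of \<open>X\<close> are independent for \<open>z \<noteq> 0\<close>, their determinant being \<open>- z ^ (n - 1)\<close>, and each
  row of \<open>Y\<close> has the same determinants with them as the corresponding row of \<open>X\<close>. The value at \<open>0\<close>
  follows by continuity.
\<close>

lemma RH_solution_unique:
  fixes X Y :: "complex \<Rightarrow> complex^2^2"
  assumes X: "RH_solution w n X" and Y: "RH_solution w n Y" and n: "n \<ge> 1" and z: "norm z \<noteq> 1"
  shows "Y z = X z"
proof -
  have punctured: "Y u = X u" if u: "norm u \<noteq> 1" "u \<noteq> 0" for u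
  proof -
    note XX = RH_solution_row_wedge[OF X X n u] and XY = RH_solution_row_wedge[OF X Y n u]
      and YX = RH_solution_row_wedge[OF Y X n u]
    have det: "X u $ 1 $ 1 * X u $ 2 $ 2 - X u $ 1 $ 2 * X u $ 2 $ 1 \<noteq> 0"
      using XX(1) u by simp
    have "Y u $ 1 $ 1 = X u $ 1 $ 1" "Y u $ 1 $ 2 = X u $ 1 $ 2"
      using eq_if_wedge_eq[OF trans[OF XY(2) XX(2)[symmetric]] trans[OF XY(1) XX(1)[symmetric]] det] .
    moreover have "Y u $ 2 $ 1 = X u $ 2 $ 1" "Y u $ 2 $ 2 = X u $ 2 $ 2"
    proof -
      \<comment> \<open>The first determinant with the roles of \<open>X\<close> and \<open>Y\<close> exchanged.\<close>
      have "X u $ 1 $ 2 * Y u $ 2 $ 1 - X u $ 1 $ 1 * Y u $ 2 $ 2 =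
            X u $ 1 $ 2 * X u $ 2 $ 1 - X u $ 1 $ 1 * X u $ 2 $ 2"
        using trans[OF YX(1) XX(1)[symmetric]] by (metis minus_diff_eq)
      then have W: "Y u $ 2 $ 1 * X u $ 1 $ 2 - Y u $ 2 $ 2 * X u $ 1 $ 1 =
            X u $ 2 $ 1 * X u $ 1 $ 2 - X u $ 2 $ 2 * X u $ 1 $ 1"
        by (simp only: mult.commute)
      show "Y u $ 2 $ 1 = X u $ 2 $ 1" "Y u $ 2 $ 2 = X u $ 2 $ 2"
        using eq_if_wedge_eq[OF W trans[OF XY(3) XX(3)[symmetric]] det] .
    qed
    ultimately show ?thesis by (simp add: matrix_eq2_iff)
  qed
  show ?thesis
  proof (cases "z = 0")
    case True
    have lim: "((\<lambda>u. Z u $ i $ j) \<longlongrightarrow> Z 0 $ i $ j) (at 0)" if "RH_solution w n Z"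
      for Z :: "complex \<Rightarrow> complex^2^2" and i j
    proof -
      have "(\<lambda>u. Z u $ i $ j) holomorphic_on ball 0 1"
        by (rule holomorphic_on_subset[OF conjunct1[OF that[unfolded RH_solution_def], rule_format]]) auto
      then have "isCont (\<lambda>u. Z u $ i $ j) 0"
        by (intro field_differentiable_imp_continuous_at
            holomorphic_on_imp_differentiable_at[OF _ open_ball]) auto
      then show ?thesis by (simp add: isCont_def)
    qed
    have "Y 0 $ i $ j = X 0 $ i $ j" for i j
    proof (rule tendsto_unique[OF _ _ lim[OF X]])
      show "((\<lambda>u. X u $ i $ j) \<longlongrightarrow> Y 0 $ i $ j) (at 0)"
        by (rule Lim_transform_within_open[OF lim[OF Y], of "ball 0 1"]) (use punctured in auto)
    qed simp
    with True show ?thesis by (simp add: vec_eq_iff)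
  qed (use punctured z in blast)
qed

section \<open>Cauchy transforms of densities on a circle\<close>

definition cauchy_transform :: "real \<Rightarrow> (complex \<Rightarrow> complex) \<Rightarrow> complex \<Rightarrow> complex" where
  "cauchy_transform \<rho> g z =
     contour_integral (circlepath 0 \<rho>) (\<lambda>s. g s / (s - z)) / (2 * of_real pi * \<i>)"

lemma cauchy_kernel_integrable:
  assumes "\<rho> > 0" "continuous_on (sphere 0 \<rho>) g" "norm z \<noteq> \<rho>"
  shows "(\<lambda>s. g s / (s - z)) contour_integrable_on circlepath 0 \<rho>"
  using assms by (intro contour_integrable_continuous_circlepath continuous_intros) auto

lemma cauchy_transform_holomorphic:
  assumes "\<rho> > 0" "continuous_on (sphere 0 \<rho>) g"
  shows "cauchy_transform \<rho> g holomorphic_on {z. norm z \<noteq> \<rho>}"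
proof -
  let ?\<gamma> = "circlepath 0 \<rho>"
  have "(\<lambda>z. contour_integral ?\<gamma> (\<lambda>s. g s / (s - z))) field_differentiable at z"
    if "norm z \<noteq> \<rho>" for z
  proof -
    have "((\<lambda>z. contour_integral ?\<gamma> (\<lambda>s. g s / (s - z))) has_field_derivative
            of_nat 1 * contour_integral ?\<gamma> (\<lambda>s. g s / (s - z) ^ Suc 1)) (at z)"
    proof (rule Cauchy_next_derivative(2)[where S = UNIV and B = "2 * pi * \<rho>"])
      show "continuous_on (path_image ?\<gamma>) g" using assms by simp
      show "norm (vector_derivative ?\<gamma> (at t)) \<le> 2 * pi * \<rho>" if "t \<in> {0..1}" for t
        using assms(1) by (simp add: vector_derivative_circlepath norm_mult)
      fix v assume "v \<in> UNIV - path_image ?\<gamma>"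
      then have "norm v \<noteq> \<rho>" using assms(1) by auto
      then show "((\<lambda>s. g s / (s - v) ^ 1) has_contour_integral
                   contour_integral ?\<gamma> (\<lambda>s. g s / (s - v))) ?\<gamma>"
        using cauchy_kernel_integrable[OF assms] by (simp add: has_contour_integral_integral)
    qed (use that assms(1) in auto)
    then show ?thesis by (auto simp: field_differentiable_def)
  qed
  then show ?thesis
    unfolding cauchy_transform_def
    by (intro holomorphic_intros) (auto simp: holomorphic_on_def field_differentiable_at_within)
qed

text \<open>
  This is \<open>s / (s - z) = 1 + z / (s - z)\<close> integrated against \<open>g\<close>. It drives all expansions below:
  read from left to right it extracts powers of \<open>z\<close> at the origin, and solved for the transform on
  the right it expands in powers of \<open>1 / z\<close> at infinity.
\<close>

lemma cauchy_transform_shift: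
  assumes "\<rho> > 0" "continuous_on (sphere 0 \<rho>) g" "norm z \<noteq> \<rho>"
  shows "cauchy_transform \<rho> (\<lambda>s. s * g s) z =
           contour_integral (circlepath 0 \<rho>) g / (2 * of_real pi * \<i>) + z * cauchy_transform \<rho> g z"
proof -
  let ?\<gamma> = "circlepath 0 \<rho>"
  have "contour_integral ?\<gamma> (\<lambda>s. s * g s / (s - z)) =
        contour_integral ?\<gamma> (\<lambda>s. g s + z * (g s / (s - z)))"
  proof (rule contour_integral_cong)
    fix s assume "s \<in> path_image ?\<gamma>"
    then have "s - z \<noteq> 0" using assms by auto
    then show "s * g s / (s - z) = g s + z * (g s / (s - z))" by (simp add: field_simps)
  qed simp
  also have "\<dots> = contour_integral ?\<gamma> g + z * contour_integral ?\<gamma> (\<lambda>s. g s / (s - z))"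
    using assms cauchy_kernel_integrable[OF assms]
    by (subst contour_integral_add)
       (auto intro: contour_integrable_lmul contour_integrable_continuous_circlepath
             simp: contour_integral_lmul simp del: times_divide_eq_right)
  finally show ?thesis
    by (simp add: cauchy_transform_def add_divide_distrib)
qed

lemma cauchy_transform_shift_power:
  assumes "\<rho> > 0" "continuous_on (sphere 0 \<rho>) g" "norm z \<noteq> \<rho>"
    and "\<And>j. j < m \<Longrightarrow> contour_integral (circlepath 0 \<rho>) (\<lambda>s. s ^ j * g s) = 0"
  shows "cauchy_transform \<rho> (\<lambda>s. s ^ m * g s) z = z ^ m * cauchy_transform \<rho> g z"
  using assms(4)
proof (induction m)
  case (Suc m)
  have "cauchy_transform \<rho> (\<lambda>s. s * (s ^ m * g s)) z = z * cauchy_transform \<rho> (\<lambda>s. s ^ m * g s) z"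
    using Suc.prems[of m] assms
    by (subst cauchy_transform_shift) (auto intro!: continuous_intros)
  with Suc show ?case by (simp add: mult.assoc)
qed simp

lemma cauchy_transform_bounded_at_infinity:
  assumes "\<rho> > 0" "continuous_on (sphere 0 \<rho>) g"
  shows "cauchy_transform \<rho> g \<in> O[at_infinity](\<lambda>_. 1)"
proof -
  have "bounded (g ` sphere 0 \<rho>)"
    using assms by (intro compact_imp_bounded compact_continuous_image) auto
  then obtain B where B: "B > 0" "\<And>s. norm s = \<rho> \<Longrightarrow> norm (g s) \<le> B"
    by (auto simp: bounded_pos)
  have "norm (cauchy_transform \<rho> g z) \<le> B * \<rho>" if z: "norm z \<ge> \<rho> + 1" for z
  proof -
    have "norm (contour_integral (circlepath 0 \<rho>) (\<lambda>s. g s / (s - z))) \<le> B * (2 * pi * \<rho>)"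
    proof (rule has_contour_integral_bound_circlepath)
      show "((\<lambda>s. g s / (s - z)) has_contour_integral
               contour_integral (circlepath 0 \<rho>) (\<lambda>s. g s / (s - z))) (circlepath 0 \<rho>)"
        using cauchy_kernel_integrable[of \<rho> g z] assms z by (simp add: has_contour_integral_integral)
      fix s :: complex assume "norm (s - 0) = \<rho>"
      then have s: "norm s = \<rho>" by simp
      then have "1 \<le> norm (s - z)"
        using norm_triangle_ineq2[of z s] z by (simp add: norm_minus_commute)
      then have "norm (g s) * 1 \<le> B * norm (s - z)"
        using B s by (intro mult_mono) auto
      then show "norm (g s / (s - z)) \<le> B"
        using \<open>1 \<le> norm (s - z)\<close> B(1) by (simp add: norm_divide divide_le_eq)
    qed (use B assms in auto)
    then show ?thesis
      by (simp add: cauchy_transform_def norm_divide norm_mult divide_le_eq field_simps)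
  qed
  then have "\<forall>\<^sub>F z in at_infinity. norm (cauchy_transform \<rho> g z) \<le> (B * \<rho>) * norm (1::complex)"
    unfolding eventually_at_infinity by auto
  then show ?thesis by (rule bigoI)
qed

text \<open>
  Concentric circles are homotopic in the annulus through the radial segments between them.
\<close>

lemma contour_integral_circle_radius:
  assumes hol: "f holomorphic_on {s. r < norm s \<and> norm s < R}"
    and r: "0 \<le> r" and a: "r < a" "a < R" and b: "r < b" "b < R"
  shows "contour_integral (circlepath 0 a) f = contour_integral (circlepath 0 b) f"
proof (rule Cauchy_theorem_homotopic_loops[OF _ _ hol])
  let ?A = "{s::complex. r < norm s \<and> norm s < R}"
  show "open ?A"
    by (intro open_Collect_conj open_Collect_less continuous_intros)
  show "homotopic_loops ?A (circlepath 0 a) (circlepath 0 b)"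
  proof (rule homotopic_loops_linear)
    fix t :: real
    let ?e = "exp (2 * of_real pi * \<i> * of_real t)"
    have e: "norm ?e = 1" by (simp add: norm_exp_eq_Re)
    show "closed_segment (circlepath 0 a t) (circlepath 0 b t) \<subseteq> ?A"
    proof
      fix s assume "s \<in> closed_segment (circlepath 0 a t) (circlepath 0 b t)"
      then obtain u where u: "0 \<le> u" "u \<le> 1"
        and s: "s = (1 - u) *\<^sub>R (of_real a * ?e) + u *\<^sub>R (of_real b * ?e)"
        by (auto simp: closed_segment_def circlepath)
      have "s = of_real ((1 - u) * a + u * b) * ?e"
        by (simp add: s scaleR_conv_of_real algebra_simps)
      then have "norm s = \<bar>(1 - u) * a + u * b\<bar>"
        by (simp only: norm_mult e norm_of_real mult_1_right)
      moreover have "(1 - u) * a + u * b \<in> {r<..<R}"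
        using convexD[of "{r<..<R}" a b "1 - u" u] u a b by simp
      ultimately show "s \<in> ?A" using r by auto
    qed
  qed auto
qed auto

lemma cauchy_transform_radius_inside:
  assumes hol: "g holomorphic_on {s. r < norm s \<and> norm s < R}"
    and r: "0 \<le> r" and a: "r < a" "a < R" and b: "r < b" "b < R"
    and z: "norm z < a" "norm z < b"
  shows "cauchy_transform a g z = cauchy_transform b g z"
proof -
  have "contour_integral (circlepath 0 a) (\<lambda>s. g s / (s - z)) =
        contour_integral (circlepath 0 b) (\<lambda>s. g s / (s - z))"
    by (rule contour_integral_circle_radius[of _ "max r (norm z)" R])
       (use assms in \<open>auto intro!: holomorphic_intros elim!: holomorphic_on_subset\<close>)
  then show ?thesis by (simp add: cauchy_transform_def)
qed

lemma cauchy_transform_radius_outside: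
  assumes hol: "g holomorphic_on {s. r < norm s \<and> norm s < R}"
    and r: "0 \<le> r" and a: "r < a" "a < R" and b: "r < b" "b < R"
    and z: "a < norm z" "b < norm z"
  shows "cauchy_transform a g z = cauchy_transform b g z"
proof -
  have "contour_integral (circlepath 0 a) (\<lambda>s. g s / (s - z)) =
        contour_integral (circlepath 0 b) (\<lambda>s. g s / (s - z))"
    by (rule contour_integral_circle_radius[of _ r "min R (norm z)"])
       (use assms in \<open>auto intro!: holomorphic_intros elim!: holomorphic_on_subset\<close>)
  then show ?thesis by (simp add: cauchy_transform_def)
qed

text \<open>
  Write \<open>g s = g z + (s - z) * k s\<close> with \<open>k\<close> holomorphic in the annulus. The part with \<open>k\<close> has the
  same integral over both circles, and the constant \<open>g z\<close> contributes only for the circle that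
  encloses \<open>z\<close>.
\<close>

lemma cauchy_transform_radius_jump:
  assumes hol: "g holomorphic_on {s. r < norm s \<and> norm s < R}"
    and r: "0 \<le> r" and ab: "r < a" "a < norm z" "norm z < b" "b < R"
  shows "cauchy_transform b g z = cauchy_transform a g z + g z"
proof -
  let ?A = "{s::complex. r < norm s \<and> norm s < R}"
  define k where "k = (\<lambda>s. if s = z then deriv (\<lambda>s. g s - g z) z else (g s - g z) / (s - z))"
  have "open ?A"
    by (intro open_Collect_conj open_Collect_less continuous_intros)
  have hk: "k holomorphic_on ?A"
    by (rule pole_theorem_open_0[of "\<lambda>s. g s - g z" _ z])
       (use \<open>open ?A\<close> in \<open>auto simp: k_def intro!: holomorphic_intros hol\<close>)
  have split: "contour_integral (circlepath 0 c) (\<lambda>s. g s / (s - z)) =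
      contour_integral (circlepath 0 c) k + g z * contour_integral (circlepath 0 c) (\<lambda>s. 1 / (s - z))"
    if c: "r < c" "c < R" "norm z \<noteq> c" for c
  proof -
    have cont: "continuous_on (sphere 0 c) k"
      using c r by (intro continuous_on_subset[OF holomorphic_on_imp_continuous_on[OF hk]]) auto
    have "contour_integral (circlepath 0 c) (\<lambda>s. g s / (s - z)) =
          contour_integral (circlepath 0 c) (\<lambda>s. k s + g z * (1 / (s - z)))"
    proof (rule contour_integral_cong)
      fix s assume "s \<in> path_image (circlepath 0 c)"
      then have "s \<noteq> z" using c r by auto
      then show "g s / (s - z) = k s + g z * (1 / (s - z))"
        by (simp add: k_def diff_divide_distrib)
    qed simp
    also have "\<dots> = contour_integral (circlepath 0 c) k
                    + g z * contour_integral (circlepath 0 c) (\<lambda>s. 1 / (s - z))"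
      using cont c r cauchy_kernel_integrable[of c "\<lambda>_. 1" z]
      by (subst contour_integral_add)
         (auto intro: contour_integrable_lmul contour_integrable_continuous_circlepath
               simp: contour_integral_lmul simp del: times_divide_eq_right)
    finally show ?thesis .
  qed
  have "contour_integral (circlepath 0 a) (\<lambda>s. 1 / (s - z)) = 0"
    by (rule contour_integral_unique, rule Cauchy_theorem_convex_simple[of _ "ball 0 (norm z)"])
       (use ab r in \<open>auto intro!: holomorphic_intros\<close>)
  moreover have "contour_integral (circlepath 0 b) (\<lambda>s. 1 / (s - z)) = 2 * of_real pi * \<i>"
    using contour_integral_unique[OF Cauchy_integral_circlepath_simple[of "\<lambda>_. 1" 0 b z]] ab by simp
  moreover have "contour_integral (circlepath 0 a) k = contour_integral (circlepath 0 b) k"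
    by (rule contour_integral_circle_radius[OF hk r]) (use ab in auto)
  ultimately show ?thesis
    using split[of a] split[of b] ab
    by (simp add: cauchy_transform_def add_divide_distrib)
qed

text \<open>
  The Plemelj jump formula. For an analytic density no singular integrals are needed: inside the
  unit circle the transform agrees with the one over a slightly larger circle, outside it with the
  one over a slightly smaller circle, and both of these are continuous at \<open>z\<close>.
\<close>

lemma cauchy_transform_boundary_values:
  assumes hol: "g holomorphic_on {s. r < norm s \<and> norm s < R}"
    and r: "0 \<le> r" "r < 1" "1 < R" and z: "norm z = 1"
  obtains l where "(cauchy_transform 1 g \<longlongrightarrow> l + g z) (at z within {u. norm u < 1})"
    and "(cauchy_transform 1 g \<longlongrightarrow> l) (at z within {u. norm u > 1})"
proof -
  define a where "a = (r + 1) / 2"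
  define b where "b = (1 + R) / 2"
  have ab: "r < a" "a < 1" "1 < b" "b < R" "a > 0" "b > 0"
    using r by (auto simp: a_def b_def)
  have lim: "(cauchy_transform c g \<longlongrightarrow> cauchy_transform c g z) (at z within S)"
    if c: "r < c" "c < R" "c \<noteq> 1" for c S
  proof -
    have "open {u::complex. norm u \<noteq> c}"
      by (intro open_Collect_neq continuous_intros)
    moreover have "continuous_on {u. norm u \<noteq> c} (cauchy_transform c g)"
      using c r by (intro holomorphic_on_imp_continuous_on cauchy_transform_holomorphic
          continuous_on_subset[OF holomorphic_on_imp_continuous_on[OF hol]]) auto
    ultimately have "isCont (cauchy_transform c g) z"
      using c z continuous_on_eq_continuous_at by fastforce
    then show ?thesis
      using isContD tendsto_within_subset by blast
  qed
  have "(cauchy_transform 1 g \<longlongrightarrow> cauchy_transform b g z) (at z within {u. norm u < 1})"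
    using lim[of b] ab
    by (rule_tac Lim_transform_eventually[where f = "cauchy_transform b g"])
       (auto simp: eventually_at_filter r intro!: always_eventually
         cauchy_transform_radius_inside[OF hol])
  moreover have "(cauchy_transform 1 g \<longlongrightarrow> cauchy_transform a g z) (at z within {u. norm u > 1})"
    using lim[of a] ab
    by (rule_tac Lim_transform_eventually[where f = "cauchy_transform a g"])
       (auto simp: eventually_at_filter r intro!: always_eventually
         cauchy_transform_radius_outside[OF hol])
  moreover have "cauchy_transform b g z = cauchy_transform a g z + g z"
    using ab z r by (intro cauchy_transform_radius_jump[OF hol]) auto
  ultimately show ?thesis using that by simp
qed

lemma cauchy_transform_cong:
  assumes "\<rho> > 0" "\<And>s. norm s = \<rho> \<Longrightarrow> f s = g s"
  shows "cauchy_transform \<rho> f z = cauchy_transform \<rho> g z"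
  unfolding cauchy_transform_def
  using assms by (intro arg_cong2[where f = "(/)"] contour_integral_cong refl) auto

lemma cauchy_transform_decay:
  assumes "\<rho> > 0" "continuous_on (sphere 0 \<rho>) g"
  shows "cauchy_transform \<rho> g \<in> O[at_infinity](\<lambda>z. 1 / z)"
proof -
  let ?M = "contour_integral (circlepath 0 \<rho>) g / (2 * of_real pi * \<i>)"
  have "(\<lambda>z. cauchy_transform \<rho> (\<lambda>s. s * g s) z - ?M) \<in> O[at_infinity](\<lambda>_. 1)"
    by (intro sum_in_bigo cauchy_transform_bounded_at_infinity)
       (use assms in \<open>auto intro!: continuous_intros\<close>)
  then have "(\<lambda>z. (cauchy_transform \<rho> (\<lambda>s. s * g s) z - ?M) * (1 / z)) \<in> O[at_infinity](\<lambda>z. 1 / z)"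
    by (rule bigo_mult_eventually_eq[OF _ landau_o.big_refl]) simp
  moreover have "\<forall>\<^sub>F z in at_infinity.
      cauchy_transform \<rho> g z = (cauchy_transform \<rho> (\<lambda>s. s * g s) z - ?M) * (1 / z)"
    unfolding eventually_at_infinity
  proof (intro exI[of _ "\<rho> + 1"] allI impI)
    fix z :: complex assume "\<rho> + 1 \<le> norm z"
    then have "norm z \<noteq> \<rho>" "z \<noteq> 0" using assms(1) by auto
    then show "cauchy_transform \<rho> g z = (cauchy_transform \<rho> (\<lambda>s. s * g s) z - ?M) * (1 / z)"
      using cauchy_transform_shift[OF assms] by simp
  qed
  ultimately show ?thesis by (simp add: landau_o.big.in_cong)
qed

section \<open>Normalised integrals over the unit circle\<close>

lemma contour_integral_eq_circle_int:
  "contour_integral (circlepath 0 1) (\<lambda>s. f s / s) = 2 * of_real pi * \<i> * circle_int f"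
proof -
  have "(\<lambda>s. f s / (2 * of_real pi * \<i> * s)) = (\<lambda>s. f s / s * (1 / (2 * of_real pi * \<i>)))"
    by (auto simp: field_simps)
  moreover have "contour_integral (circlepath 0 1) (\<lambda>s. f s / s * (1 / (2 * of_real pi * \<i>))) =
      contour_integral (circlepath 0 1) (\<lambda>s. f s / s) * (1 / (2 * of_real pi * \<i>))"
  proof (cases "(\<lambda>s. f s / s) contour_integrable_on circlepath 0 1")
    case False
    then have "\<not> (\<lambda>s. f s / s * (1 / (2 * of_real pi * \<i>))) contour_integrable_on circlepath 0 1"
      using contour_integrable_rmul[of "\<lambda>s. f s / s * (1 / (2 * of_real pi * \<i>))"
          "circlepath 0 1" "2 * of_real pi * \<i>"] by auto
    with False show ?thesis by (simp add: not_integrable_contour_integral)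
  qed (rule contour_integral_rmul)
  ultimately show ?thesis
    by (simp add: circle_int_def)
qed

lemma circle_int_cong:
  assumes "\<And>s. norm s = 1 \<Longrightarrow> f s = g s"
  shows "circle_int f = circle_int g"
  unfolding circle_int_def using assms by (intro contour_integral_cong) auto

lemma circle_integrable:
  assumes "continuous_on (sphere 0 1) f"
  shows "(\<lambda>s. f s / s) contour_integrable_on circlepath 0 1"
  using assms by (intro contour_integrable_continuous_circlepath continuous_intros) auto

lemma circle_int_add:
  assumes "continuous_on (sphere 0 1) f" "continuous_on (sphere 0 1) g"
  shows "circle_int (\<lambda>s. f s + g s) = circle_int f + circle_int g"
proof -
  have "2 * of_real pi * \<i> * circle_int (\<lambda>s. f s + g s) =
        2 * of_real pi * \<i> * (circle_int f + circle_int g)"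
    using contour_integral_add[OF circle_integrable circle_integrable, OF assms]
    by (simp add: distrib_left add_divide_distrib flip: contour_integral_eq_circle_int)
  then show ?thesis by simp
qed

lemma circle_int_cmult:
  assumes "continuous_on (sphere 0 1) f"
  shows "circle_int (\<lambda>s. c * f s) = c * circle_int f"
proof -
  have "2 * of_real pi * \<i> * circle_int (\<lambda>s. c * f s) = 2 * of_real pi * \<i> * (c * circle_int f)"
    using contour_integral_lmul[OF circle_integrable, OF assms, of c]
      contour_integral_eq_circle_int[of "\<lambda>s. c * f s"] contour_integral_eq_circle_int[of f]
    by (simp add: algebra_simps)
  then show ?thesis by simp
qed

text \<open>
  \<open>(s + z) / (s - z) = 1 + 2 * z / (s - z)\<close>: the Herglotz kernel of the associated functions
  reduces to the Cauchy kernel.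
\<close>

lemma circle_int_schwarz_kernel:
  assumes f: "continuous_on (sphere 0 1) f" and z: "norm z \<noteq> 1"
  shows "circle_int (\<lambda>s. (s + z) / (s - z) * f s) =
           circle_int f + 2 * z * cauchy_transform 1 (\<lambda>s. f s / s) z"
proof -
  let ?C = "circlepath 0 1"
  have cont: "continuous_on (sphere 0 1) (\<lambda>s. f s / s)"
    by (intro continuous_intros f) auto
  have int: "(\<lambda>s. f s / s) contour_integrable_on ?C" "(\<lambda>s. f s / s / (s - z)) contour_integrable_on ?C"
    using circle_integrable[OF f] cauchy_kernel_integrable[of 1, OF _ cont z] by simp_all
  have "contour_integral ?C (\<lambda>s. (s + z) / (s - z) * f s / s) =
        contour_integral ?C (\<lambda>s. f s / s + 2 * z * (f s / s / (s - z)))"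
  proof (rule contour_integral_cong)
    fix s assume "s \<in> path_image ?C"
    then have "s \<noteq> z" "s \<noteq> 0" using z by auto
    then have "(s + z) / (s - z) = 1 + 2 * z * (1 / (s - z))" by (simp add: field_simps)
    then show "(s + z) / (s - z) * f s / s = f s / s + 2 * z * (f s / s / (s - z))"
      by (simp only:) (simp add: distrib_left distrib_right add_divide_distrib mult_ac)
  qed simp
  also have "\<dots> = contour_integral ?C (\<lambda>s. f s / s) + 2 * z * contour_integral ?C (\<lambda>s. f s / s / (s - z))"
    by (simp only: contour_integral_add[OF int(1) contour_integrable_lmul[OF int(2)]]
          contour_integral_lmul[OF int(2)])
  also have "contour_integral ?C (\<lambda>s. f s / s / (s - z)) =
      2 * of_real pi * \<i> * cauchy_transform 1 (\<lambda>s. f s / s) z"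
    by (simp add: cauchy_transform_def)
  also have "contour_integral ?C (\<lambda>s. f s / s) + 2 * z * \<dots> =
      2 * of_real pi * \<i> * (circle_int f + 2 * z * cauchy_transform 1 (\<lambda>s. f s / s) z)"
    unfolding contour_integral_eq_circle_int[of f] by (simp only: distrib_left mult_ac)
  finally show ?thesis
    unfolding contour_integral_eq_circle_int by simp
qed

section \<open>Bi-orthogonality\<close>

text \<open>
  Subtracting a multiple of \<open>P n\<close> lowers the degree of \<open>q\<close>, and a polynomial of degree below \<open>n\<close> is
  a combination of the \<open>P k\<close> with \<open>k < n\<close>, all annihilated by \<open>\<Lambda>\<close>.
\<close>

lemma linear_functional_top_coeff:
  fixes \<Lambda> :: "complex poly \<Rightarrow> complex" and P :: "nat \<Rightarrow> complex poly"
  assumes add: "\<And>p q. \<Lambda> (p + q) = \<Lambda> p + \<Lambda> q" and smult: "\<And>c p. \<Lambda> (smult c p) = c * \<Lambda> p"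
    and deg: "\<And>k. degree (P k) = k" and nz: "\<And>k. coeff (P k) k \<noteq> 0"
    and zero: "\<And>k. k < n \<Longrightarrow> \<Lambda> (P k) = 0" and q: "degree q \<le> n"
  shows "\<Lambda> q = coeff q n / coeff (P n) n * \<Lambda> (P n)"
  using zero q
proof (induction n arbitrary: q)
  case (0 q)
  then have "q = smult (coeff q 0 / coeff (P 0) 0) (P 0)"
    using deg[of 0] nz[of 0]
    by (intro poly_eqI, rename_tac i, case_tac "i = 0") (simp_all add: coeff_eq_0)
  then show ?case using smult by metis
next
  case (Suc n q)
  define c where "c = coeff q (Suc n) / coeff (P (Suc n)) (Suc n)"
  define q' where "q' = q - smult c (P (Suc n))"
  have "degree q' \<le> n"
  proof (rule degree_le, intro allI impI)
    fix i assume "n < i"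
    then consider "i = Suc n" | "i > Suc n" by linarith
    then show "coeff q' i = 0"
      using nz[of "Suc n"] Suc.prems(2) deg[of "Suc n"]
      by cases (auto simp: q'_def c_def coeff_eq_0)
  qed
  then have "\<Lambda> q' = 0"
    using Suc.IH[of q'] Suc.prems(1) by simp
  moreover have "q = q' + smult c (P (Suc n))" by (simp add: q'_def)
  then have "\<Lambda> q = \<Lambda> q' + c * \<Lambda> (P (Suc n))" using add smult by metis
  ultimately show ?case by (simp add: c_def)
qed

lemma continuous_on_poly_inverse_circle:
  "continuous_on (sphere 0 1) (\<lambda>s::complex. poly q (1 / s))"
  by (intro continuous_intros) auto

lemma biorthonormal_left:
  assumes bi: "biorthonormal w \<kappa> \<phi> \<phi>b" and w: "continuous_on (sphere 0 1) w"
    and q: "degree q \<le> n"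
  shows "circle_int (\<lambda>s. w s * poly (\<phi> n) s * poly q (1 / s)) = coeff q n / \<kappa> n"
proof -
  let ?\<Lambda> = "\<lambda>q. circle_int (\<lambda>s. w s * poly (\<phi> n) s * poly q (1 / s))"
  have b: "degree (\<phi>b k) = k" "coeff (\<phi>b k) k = \<kappa> k" "\<kappa> k \<noteq> 0" for k
    using bi by (auto simp: biorthonormal_def) metis
  have "?\<Lambda> q = coeff q n / coeff (\<phi>b n) n * ?\<Lambda> (\<phi>b n)"
  proof (rule linear_functional_top_coeff[where P = \<phi>b])
    show "?\<Lambda> (p + q) = ?\<Lambda> p + ?\<Lambda> q" for p q
      using w by (subst circle_int_add[symmetric])
        (auto intro!: continuous_intros continuous_on_poly_inverse_circle simp: distrib_left)
    show "?\<Lambda> (smult c p) = c * ?\<Lambda> p" for c p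
      using w by (subst circle_int_cmult[symmetric])
        (auto intro!: continuous_intros continuous_on_poly_inverse_circle simp: mult_ac)
    show "?\<Lambda> (\<phi>b k) = 0" if "k < n" for k
      using bi that by (simp add: biorthonormal_def)
  qed (use b q in auto)
  moreover have "?\<Lambda> (\<phi>b n) = 1" using bi by (simp add: biorthonormal_def)
  ultimately show ?thesis by (simp add: b)
qed

lemma biorthonormal_right:
  assumes bi: "biorthonormal w \<kappa> \<phi> \<phi>b" and w: "continuous_on (sphere 0 1) w"
    and q: "degree q \<le> n"
  shows "circle_int (\<lambda>s. w s * poly q s * poly (\<phi>b n) (1 / s)) = coeff q n / \<kappa> n"
proof -
  let ?\<Lambda> = "\<lambda>q. circle_int (\<lambda>s. w s * poly q s * poly (\<phi>b n) (1 / s))"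
  have b: "degree (\<phi> k) = k" "coeff (\<phi> k) k = \<kappa> k" "\<kappa> k \<noteq> 0" for k
    using bi by (auto simp: biorthonormal_def) metis
  have "?\<Lambda> q = coeff q n / coeff (\<phi> n) n * ?\<Lambda> (\<phi> n)"
  proof (rule linear_functional_top_coeff[where P = \<phi>])
    show "?\<Lambda> (p + q) = ?\<Lambda> p + ?\<Lambda> q" for p q
      using w by (subst circle_int_add[symmetric])
        (auto intro!: continuous_intros continuous_on_poly_inverse_circle simp: algebra_simps)
    show "?\<Lambda> (smult c p) = c * ?\<Lambda> p" for c p
      using w by (subst circle_int_cmult[symmetric])
        (auto intro!: continuous_intros continuous_on_poly_inverse_circle simp: mult_ac)
    show "?\<Lambda> (\<phi> k) = 0" if "k < n" for k
      using bi that by (simp add: biorthonormal_def)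
  qed (use b q in auto)
  moreover have "?\<Lambda> (\<phi> n) = 1" using bi by (simp add: biorthonormal_def)
  ultimately show ?thesis by (simp add: b)
qed

lemma biorthonormal_polys:
  assumes "biorthonormal w \<kappa> \<phi> \<phi>b"
  shows "\<kappa> n \<noteq> 0" "degree (\<phi> n) = n" "coeff (\<phi> n) n = \<kappa> n" "degree (\<phi>b n) = n" "coeff (\<phi>b n) n = \<kappa> n"
  using assms unfolding biorthonormal_def by metis+

lemma biorthonormal_moments:
  assumes bi: "biorthonormal w \<kappa> \<phi> \<phi>b" and w: "continuous_on (sphere 0 1) w"
  shows "k < n \<Longrightarrow> circle_int (\<lambda>s. w s * poly (\<phi> n) s * (1 / s) ^ k) = 0"
    and "k < n \<Longrightarrow> circle_int (\<lambda>s. w s * s ^ k * poly (\<phi>b n) (1 / s)) = 0"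
    and "circle_int (\<lambda>s. w s * s ^ n * poly (\<phi>b n) (1 / s)) = 1 / \<kappa> n"
  using biorthonormal_left[OF bi w, of "monom 1 k" n]
    biorthonormal_right[OF bi w, of "monom 1 k" n] biorthonormal_right[OF bi w, of "monom 1 n" n]
  by (simp_all add: poly_monom degree_monom_eq)

section \<open>Analyticity of the weight near the unit circle\<close>

lemma power_series_suminf_holomorphic:
  fixes b :: "nat \<Rightarrow> complex"
  assumes "0 \<le> r" "r < R"
    and "\<And>u. r < norm u \<Longrightarrow> norm u < R \<Longrightarrow> summable (\<lambda>k. b k * u ^ k)"
  shows "(\<lambda>u. \<Sum>k. b k * u ^ k) holomorphic_on ball 0 R"
proof (rule power_series_holomorphic)
  fix u :: complex assume "u \<in> ball 0 R"
  \<comment> \<open>Convergence is known only in the annulus; a point there of modulus above \<open>norm u\<close> suffices.\<close>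
  then have "max r (norm u) < R" using assms by simp
  then obtain x where x: "max r (norm u) < x" "x < R" using dense by blast
  then have "summable (\<lambda>k. b k * of_real x ^ k)"
    using assms by (intro assms(3)) auto
  then have "summable (\<lambda>k. b k * u ^ k)"
    by (rule powser_inside) (use x assms in auto)
  then show "(\<lambda>k. b k * (u - 0) ^ k) sums (\<Sum>k. b k * u ^ k)"
    by (simp add: summable_sums)
qed

text \<open>
  Absolute convergence allows the series to be split into its nonnegative part, a power series in
  \<open>z\<close>, and its negative part, \<open>1 / z\<close> times a power series in \<open>1 / z\<close>.
\<close>

lemma laurent_series_holomorphic:
  fixes a :: "int \<Rightarrow> complex"
  assumes rR: "0 < r" "r < R"
    and sum: "\<And>z. r < norm z \<Longrightarrow> norm z < R \<Longrightarrow> ((\<lambda>k. a k * z powi k) has_sum w z) UNIV"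
  shows "w holomorphic_on {z. r < norm z \<and> norm z < R}"
proof -
  let ?neg = "\<lambda>k::nat. - int k - 1" and ?A = "{z::complex. r < norm z \<and> norm z < R}"
  have halves: "(\<lambda>k. a (int k) * z ^ k) sums infsum (\<lambda>k. a k * z powi k) {0..}"
    "(\<lambda>k. a (?neg k) * z powi ?neg k) sums infsum (\<lambda>k. a k * z powi k) {..<0}"
    "w z = infsum (\<lambda>k. a k * z powi k) {0..} + infsum (\<lambda>k. a k * z powi k) {..<0}"
    if z: "r < norm z" "norm z < R" for z
  proof -
    let ?f = "\<lambda>k. a k * z powi k"
    have f: "?f summable_on A" for A
      using sum[OF z] summable_on_subset_banach[of ?f UNIV A] by (auto simp: summable_on_def)
    have "w z = infsum ?f UNIV" using sum[OF z] by (rule infsumI[symmetric])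
    also have "UNIV = {0..} \<union> {..<0::int}" by auto
    also have "infsum ?f ({0..} \<union> {..<0}) = infsum ?f {0..} + infsum ?f {..<0}"
      by (rule infsum_Un_disjoint[OF f f]) auto
    finally show "w z = infsum ?f {0..} + infsum ?f {..<0}" .
    have "range int = {0..}" by (auto simp: image_iff) (metis nonneg_int_cases)
    with f[of "{0..}"] have "(?f has_sum infsum ?f {0..}) (range int)" by simp
    then have "((\<lambda>k. ?f (int k)) has_sum infsum ?f {0..}) UNIV"
      by (subst (asm) has_sum_reindex) (auto simp: o_def)
    then show "(\<lambda>k. a (int k) * z ^ k) sums infsum ?f {0..}"
      using has_sum_imp_sums by force
    have "k \<in> range ?neg" if "k < 0" for k
      by (rule range_eqI[of _ _ "nat (- k - 1)"]) (use that in simp)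
    then have "range ?neg = {..<0}" by auto
    with f[of "{..<0}"] have "(?f has_sum infsum ?f {..<0}) (range ?neg)" by simp
    then have "((\<lambda>k. ?f (?neg k)) has_sum infsum ?f {..<0}) UNIV"
      by (subst (asm) has_sum_reindex) (auto simp: o_def inj_on_def)
    then show "(\<lambda>k. a (?neg k) * z powi ?neg k) sums infsum ?f {..<0}"
      by (rule has_sum_imp_sums)
  qed
  define F where "F = (\<lambda>u. \<Sum>k. a (int k) * u ^ k)"
  define G where "G = (\<lambda>u. \<Sum>k. a (?neg k) * u ^ k)"
  have powi_neg: "z powi ?neg k = (1 / z) * (1 / z) ^ k" if "z \<noteq> 0" for z :: complex and k
  proof -
    have "?neg k = - int (Suc k)" by simp
    then show ?thesis
      by (simp only: power_int_minus power_int_of_nat) (simp add: field_simps)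
  qed
  have neg_sums: "(\<lambda>k. a (?neg k) * (1 / z) ^ k) sums (z * infsum (\<lambda>k. a k * z powi k) {..<0})"
    if z: "r < norm z" "norm z < R" for z
  proof -
    have "z \<noteq> 0" using z rR by auto
    with sums_mult[OF halves(2)[OF z], of z] show ?thesis
      by (simp add: powi_neg mult_ac)
  qed
  have holF: "F holomorphic_on ball 0 R"
    unfolding F_def by (rule power_series_suminf_holomorphic[of r])
      (use rR halves(1) in \<open>auto simp: sums_iff\<close>)
  have holG: "G holomorphic_on ball 0 (1 / r)"
    unfolding G_def
  proof (rule power_series_suminf_holomorphic[of "1 / R"])
    show "1 / R < 1 / r" using rR by (simp add: frac_less2)
    fix u :: complex assume u: "1 / R < norm u" "norm u < 1 / r"
    then have "u \<noteq> 0" using rR by auto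
    with u rR have "r < norm (1 / u)" "norm (1 / u) < R"
      by (auto simp: norm_divide field_simps)
    from neg_sums[OF this] show "summable (\<lambda>k. a (?neg k) * u ^ k)" by (simp add: sums_iff)
  qed (use rR in auto)
  have "(\<lambda>z::complex. F z + 1 / z * G (1 / z)) holomorphic_on ?A"
  proof (intro holomorphic_intros)
    show "F holomorphic_on ?A"
      by (rule holomorphic_on_subset[OF holF]) auto
    show "(\<lambda>z. G (1 / z)) holomorphic_on ?A"
      by (rule holomorphic_on_compose_gen[OF _ holG, unfolded o_def])
         (use rR in \<open>auto intro!: holomorphic_intros simp: norm_divide frac_less2\<close>)
  qed (use rR in auto)
  then show ?thesis
  proof (rule holomorphic_transform)
    fix z assume "z \<in> ?A"
    then have z: "r < norm z" "norm z < R" by auto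
    then have "z \<noteq> 0" using rR by auto
    moreover have "F z = infsum (\<lambda>k. a k * z powi k) {0..}"
      "G (1 / z) = z * infsum (\<lambda>k. a k * z powi k) {..<0}"
      using halves(1)[OF z] neg_sums[OF z] by (simp_all add: F_def G_def sums_iff)
    ultimately show "F z + 1 / z * G (1 / z) = w z"
      using halves(3)[OF z] by simp
  qed
qed

text \<open>
  Raising the inner radius to at least \<open>1 / 2\<close> makes it positive, so that \<open>1 / r\<close> is a radius of
  convergence in the variable \<open>1 / z\<close>.
\<close>

lemma admissible_weight_annulus:
  assumes "admissible_weight w"
  obtains r R where "0 < r" "r < 1" "1 < R" "w holomorphic_on {z. r < norm z \<and> norm z < R}"
proof -
  obtain r R where r: "0 \<le> r" "r < 1" "1 < R" and sum: "\<And>z. r < norm z \<Longrightarrow> norm z < R \<Longrightarrow>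
      ((\<lambda>k::int. fourier_coeff w k * z powi k) has_sum w z) UNIV"
    using assms unfolding admissible_weight_def by blast
  have "w holomorphic_on {z. max r (1 / 2) < norm z \<and> norm z < R}"
    by (rule laurent_series_holomorphic[where a = "fourier_coeff w"]) (use r sum in auto)
  with r show ?thesis by (intro that[of "max r (1 / 2)" R]) auto
qed

section \<open>Existence\<close>

lemma remove_sings_eq_holomorphic:
  assumes "F holomorphic_on A" "open A" "z \<in> A" "\<And>u. u \<in> A \<Longrightarrow> u \<noteq> 0 \<Longrightarrow> f u = F u"
  shows "remove_sings f z = F z"
proof (rule remove_sings_eqI)
  have "isCont F z"
    using assms by (intro field_differentiable_imp_continuous_at holomorphic_on_imp_differentiable_at)
  then have "(F \<longlongrightarrow> F z) (at z)" by (simp add: isCont_def)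
  moreover have "\<forall>\<^sub>F u in at z. u \<in> A \<and> u \<noteq> 0"
    using eventually_at_in_open'[OF assms(2,3)] eventually_neq_at_within[of 0 z UNIV]
    by (rule eventually_conj)
  then have "\<forall>\<^sub>F u in at z. F u = f u"
    by eventually_elim (use assms(4) in simp)
  ultimately show "(f \<longlongrightarrow> F z) (at z)" by (rule Lim_transform_eventually)
qed

text \<open>
  Here \<open>g\<close> and \<open>h\<close> are the densities of the two entries of the second column, up to the constants
  \<open>1 / \<kappa> n\<close> and \<open>\<kappa> n\<close>. On the circle \<open>g = s ^ (n - 1) * g0\<close> and \<open>h = s ^ n * h0\<close>, and the moments
  that permit these powers of \<open>s\<close> to be taken out as powers of \<open>z\<close> vanish by bi-orthogonality.
  The function \<open>h0\<close> is also the density that the definition of the second associated function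
  provides.
\<close>

lemma RH_matrix_is_solution:
  assumes bi: "biorthonormal w \<kappa> \<phi> \<phi>b" and n: "n \<ge> 1"
    and r: "0 < r" "r < 1" "1 < R" and hol: "w holomorphic_on {z. r < norm z \<and> norm z < R}"
  shows "RH_solution w n (RH_matrix w \<kappa> \<phi> \<phi>b n)"
proof -
  let ?A = "{z::complex. r < norm z \<and> norm z < R}" and ?off = "{z::complex. norm z \<noteq> 1}"
    and ?q = "reflect_poly (\<phi>b n)"
  note polys = biorthonormal_polys[OF bi, of n]
  have contw: "continuous_on (sphere 0 1) w"
    by (rule continuous_on_subset[OF holomorphic_on_imp_continuous_on[OF hol]]) (use r in auto)
  note moments = biorthonormal_moments[OF bi contw]
  have openoff: "open ?off"
    by (intro open_Collect_neq continuous_intros)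
  define g where "g = (\<lambda>s. w s * poly (\<phi> n) s / s)"
  define h where "h = (\<lambda>s. w s * poly ?q s / s)"
  define g0 where "g0 = (\<lambda>s. w s * poly (\<phi> n) s * (1 / s) ^ (n - 1) / s)"
  define h0 where "h0 = (\<lambda>s. w s * poly (\<phi>b n) (1 / s) / s)"
  have cont: "continuous_on (sphere 0 1) g" "continuous_on (sphere 0 1) h"
    "continuous_on (sphere 0 1) g0" "continuous_on (sphere 0 1) h0"
    unfolding g_def h_def g0_def h0_def by (intro continuous_intros contw; force)+
  have reflect: "poly ?q s = s ^ n * poly (\<phi>b n) (1 / s)" if "norm s = 1" for s
    using that poly_reflect_poly_biorthonormal[OF bi, of s] by fastforce
  have g_eq: "cauchy_transform 1 g z = z ^ (n - 1) * cauchy_transform 1 g0 z"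
    if z: "norm z \<noteq> 1" for z
  proof -
    have "cauchy_transform 1 g z = cauchy_transform 1 (\<lambda>s. s ^ (n - 1) * g0 s) z"
    proof (rule cauchy_transform_cong)
      fix s :: complex assume "norm s = 1"
      then have "s \<noteq> 0" by auto
      then show "g s = s ^ (n - 1) * g0 s" by (simp add: g_def g0_def power_one_over)
    qed simp
    also have "\<dots> = z ^ (n - 1) * cauchy_transform 1 g0 z"
    proof (rule cauchy_transform_shift_power[OF _ cont(3) z])
      fix j assume j: "j < n - 1"
      have "contour_integral (circlepath 0 1) (\<lambda>s. s ^ j * g0 s) =
            contour_integral (circlepath 0 1) (\<lambda>s. w s * poly (\<phi> n) s * (1 / s) ^ (n - 1 - j) / s)"
      proof (rule contour_integral_cong)
        fix s :: complex assume "s \<in> path_image (circlepath 0 1)"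
        then have "s \<noteq> 0" by auto
        moreover have "n - 1 = j + (n - 1 - j)" using j by simp
        then have "(1 / s) ^ (n - 1) = (1 / s) ^ j * (1 / s) ^ (n - 1 - j)" by (metis power_add)
        ultimately show "s ^ j * g0 s = w s * poly (\<phi> n) s * (1 / s) ^ (n - 1 - j) / s"
          by (simp add: g0_def power_one_over)
      qed simp
      also have "\<dots> = 0"
        unfolding contour_integral_eq_circle_int using moments(1)[of "n - 1 - j" n] n by simp
      finally show "contour_integral (circlepath 0 1) (\<lambda>s. s ^ j * g0 s) = 0" .
    qed simp
    finally show ?thesis .
  qed
  have h_eq: "cauchy_transform 1 h z = z ^ n * cauchy_transform 1 h0 z"
    if z: "norm z \<noteq> 1" for z
  proof -
    have "cauchy_transform 1 h z = cauchy_transform 1 (\<lambda>s. s ^ n * h0 s) z"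
      by (rule cauchy_transform_cong) (simp_all add: h_def h0_def reflect)
    also have "\<dots> = z ^ n * cauchy_transform 1 h0 z"
    proof (rule cauchy_transform_shift_power[OF _ cont(4) z])
      fix j assume j: "j < n"
      have "(\<lambda>s. s ^ j * h0 s) = (\<lambda>s. w s * s ^ j * poly (\<phi>b n) (1 / s) / s)"
        by (simp add: h0_def mult_ac)
      then show "contour_integral (circlepath 0 1) (\<lambda>s. s ^ j * h0 s) = 0"
        using moments(2)[OF j] by (simp add: contour_integral_eq_circle_int)
    qed simp
    finally show ?thesis .
  qed
  have holC: "cauchy_transform 1 f holomorphic_on ?off" if "continuous_on (sphere 0 1) f" for f
    using cauchy_transform_holomorphic[OF _ that] by simp
  define X where "X = RH_matrix w \<kappa> \<phi> \<phi>b n"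
  have X1: "X z $ 1 $ 1 = poly (\<phi> n) z / \<kappa> n" "X z $ 2 $ 1 = \<kappa> n * poly ?q z" for z
    by (simp_all add: X_def RH_matrix_def)
  have X12: "X z $ 1 $ 2 = cauchy_transform 1 g z / \<kappa> n" if "norm z \<noteq> 1" for z
    unfolding X_def RH_matrix_def matrix2_nth
  proof (rule remove_sings_eq_holomorphic[OF _ openoff])
    show "(\<lambda>z. cauchy_transform 1 g z / \<kappa> n) holomorphic_on ?off"
      by (intro holomorphic_intros holC cont) (use polys in simp)
    fix u assume u: "u \<in> ?off" "u \<noteq> 0"
    have "assoc_eps w \<phi> n u = circle_int (\<lambda>s. w s * poly (\<phi> n) s) + 2 * u * cauchy_transform 1 g u"
      unfolding assoc_eps_def g_def mult.assoc[of _ "w _"]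
      by (rule circle_int_schwarz_kernel) (use u in \<open>auto intro!: continuous_intros contw\<close>)
    then show "assoc_eps w \<phi> n u / (2 * \<kappa> n * u) = cauchy_transform 1 g u / \<kappa> n"
      using moments(1)[of 0 n] n u polys by simp
  qed (use that in simp)
  have X22: "X z $ 2 $ 2 = \<kappa> n * cauchy_transform 1 h z" if "norm z \<noteq> 1" for z
    unfolding X_def RH_matrix_def matrix2_nth
  proof (rule remove_sings_eq_holomorphic[OF _ openoff])
    show "(\<lambda>z. \<kappa> n * cauchy_transform 1 h z) holomorphic_on ?off"
      by (intro holomorphic_intros holC cont)
    fix u assume u: "u \<in> ?off" "u \<noteq> 0"
    have "circle_int (\<lambda>s. (s + u) / (s - u) * w s * poly (\<phi>b n) (1 / s)) =
        circle_int (\<lambda>s. w s * poly (\<phi>b n) (1 / s)) + 2 * u * cauchy_transform 1 h0 u"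
      unfolding h0_def mult.assoc[of _ "w _"]
      by (rule circle_int_schwarz_kernel)
         (use u in \<open>auto intro!: continuous_intros continuous_on_poly_inverse_circle contw\<close>)
    then have "assoc_eps_star w \<phi>b n u = - (u ^ n) * (2 * u * cauchy_transform 1 h0 u)"
      using moments(2)[of 0 n] n by (simp add: assoc_eps_star_def)
    then show "- (\<kappa> n * assoc_eps_star w \<phi>b n u / (2 * u)) = \<kappa> n * cauchy_transform 1 h u"
      using u h_eq[of u] by simp
  qed (use that in simp)
  have off: "\<forall>\<^sub>F u in at_infinity. norm u \<noteq> (1::real) \<and> u \<noteq> (0::complex)"
    unfolding eventually_at_infinity by (rule exI[of _ 2]) auto
  have off0: "\<forall>\<^sub>F u in at 0. norm (u::complex) \<noteq> 1"
    unfolding eventually_at by (rule exI[of _ 1]) (auto simp: dist_norm)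
  have holgh: "g holomorphic_on ?A" "h holomorphic_on ?A"
    unfolding g_def h_def by (intro holomorphic_intros hol; use r in force)+
  have jump: "\<exists>l. ((\<lambda>u. X u $ i $ 2) \<longlongrightarrow> c * (l + f z)) (at z within {u. norm u < 1}) \<and>
      ((\<lambda>u. X u $ i $ 2) \<longlongrightarrow> c * l) (at z within {u. norm u > 1})"
    if f: "f holomorphic_on ?A" and z: "norm z = 1"
      and eq: "\<And>u. norm u \<noteq> 1 \<Longrightarrow> X u $ i $ 2 = c * cauchy_transform 1 f u" for f z c and i :: 2
  proof -
    obtain l where l: "(cauchy_transform 1 f \<longlongrightarrow> l + f z) (at z within {u. norm u < 1})"
      "(cauchy_transform 1 f \<longlongrightarrow> l) (at z within {u. norm u > 1})"
      using cauchy_transform_boundary_values[OF f _ r(2,3) z] r(1) by auto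
    have "((\<lambda>u. X u $ i $ 2) \<longlongrightarrow> c * (l + f z)) (at z within {u. norm u < 1})"
      by (rule Lim_transform_eventually[OF tendsto_mult_left[OF l(1)]])
         (auto simp: eventually_at_filter eq)
    moreover have "((\<lambda>u. X u $ i $ 2) \<longlongrightarrow> c * l) (at z within {u. norm u > 1})"
      by (rule Lim_transform_eventually[OF tendsto_mult_left[OF l(2)]])
         (auto simp: eventually_at_filter eq)
    ultimately show ?thesis by blast
  qed
  have poly_lim: "(poly p \<longlongrightarrow> poly p z) (at z within S)" for p :: "complex poly" and z S
    by (intro tendsto_intros)
  show ?thesis
    unfolding RH_solution_iff_entries[OF n] X_def[symmetric]
  proof (intro conjI allI impI)
    fix i j :: 2
    have off_eq: "{z::complex. norm z > 1} \<union> {z. norm z < 1} = ?off" by auto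
    have "(\<lambda>z. X z $ 1 $ 1) holomorphic_on ?off" "(\<lambda>z. X z $ 2 $ 1) holomorphic_on ?off"
      unfolding X1 by (intro holomorphic_intros; use polys in simp)+
    moreover have "(\<lambda>z. X z $ 1 $ 2) holomorphic_on ?off"
      by (rule holomorphic_transform[of "\<lambda>z. cauchy_transform 1 g z / \<kappa> n"])
         (use polys in \<open>auto intro!: holomorphic_intros holC cont simp: X12\<close>)
    moreover have "(\<lambda>z. X z $ 2 $ 2) holomorphic_on ?off"
      by (rule holomorphic_transform[of "\<lambda>z. \<kappa> n * cauchy_transform 1 h z"])
         (auto intro!: holomorphic_intros holC cont simp: X22)
    ultimately show "(\<lambda>z. X z $ i $ j) holomorphic_on {z. norm z > 1} \<union> {z. norm z < 1}"
      unfolding off_eq using exhaust_2[of i] exhaust_2[of j] by auto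
  next
    fix z :: complex and i :: 2 assume z: "norm z = 1"
    obtain l where l: "((\<lambda>u. X u $ 1 $ 2) \<longlongrightarrow> 1 / \<kappa> n * (l + g z)) (at z within {u. norm u < 1})"
      "((\<lambda>u. X u $ 1 $ 2) \<longlongrightarrow> 1 / \<kappa> n * l) (at z within {u. norm u > 1})"
      using jump[OF holgh(1) z, of 1 "1 / \<kappa> n"] X12 by auto
    obtain m where m: "((\<lambda>u. X u $ 2 $ 2) \<longlongrightarrow> \<kappa> n * (m + h z)) (at z within {u. norm u < 1})"
      "((\<lambda>u. X u $ 2 $ 2) \<longlongrightarrow> \<kappa> n * m) (at z within {u. norm u > 1})"
      using jump[OF holgh(2) z, of 2 "\<kappa> n"] X22 by auto
    have lim1: "((\<lambda>u. X u $ 1 $ 1) \<longlongrightarrow> poly (\<phi> n) z / \<kappa> n) (at z within S)"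
      "((\<lambda>u. X u $ 2 $ 1) \<longlongrightarrow> \<kappa> n * poly ?q z) (at z within S)" for S
      unfolding X1 by (intro tendsto_intros poly_lim; use polys in simp)+
    have vals: "1 / \<kappa> n * (l + g z) = poly (\<phi> n) z / \<kappa> n * (w z / z) + 1 / \<kappa> n * l"
      "\<kappa> n * (m + h z) = \<kappa> n * poly ?q z * (w z / z) + \<kappa> n * m"
      by (simp_all add: g_def h_def distrib_left add_divide_distrib mult_ac)
    consider "i = 1" | "i = 2" using exhaust_2 by blast
    then show "\<exists>a b.
        ((\<lambda>u. X u $ i $ 1) \<longlongrightarrow> a) (at z within {u. norm u < 1}) \<and>
        ((\<lambda>u. X u $ i $ 1) \<longlongrightarrow> a) (at z within {u. norm u > 1}) \<and>
        ((\<lambda>u. X u $ i $ 2) \<longlongrightarrow> a * (w z / z) + b) (at z within {u. norm u < 1}) \<and>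
        ((\<lambda>u. X u $ i $ 2) \<longlongrightarrow> b) (at z within {u. norm u > 1})"
    proof cases
      case 1
      show ?thesis
        unfolding 1 using lim1(1) l[unfolded vals] by blast
    next
      case 2
      show ?thesis
        unfolding 2 using lim1(2) m[unfolded vals] by blast
    qed
  next
    \<comment> \<open>The upper left entry is monic of degree \<open>n\<close>; only its lower part \<open>p\<close> contributes to the error.\<close>
    define p where "p = smult (1 / \<kappa> n) (\<phi> n) - monom 1 n"
    have "degree p \<le> n - 1"
    proof (rule degree_le, intro allI impI)
      fix i assume "n - 1 < i"
      then consider "i = n" | "i > n" by linarith
      then show "coeff p i = 0"
        using polys by cases (auto simp: p_def coeff_eq_0)
    qed
    moreover have "z ^ (n - 1) / z ^ n = 1 / z" if "z \<noteq> 0" for z :: complex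
      using n that by (cases n) auto
    ultimately have "(\<lambda>z. poly p z / z ^ n) \<in> O[at_infinity](\<lambda>z. 1 / z)"
      by (intro bigo_divide_power[OF poly_bigo_at_infinity]) (auto intro!: eventually_mono[OF off])
    moreover have "\<forall>\<^sub>F z in at_infinity. X z $ 1 $ 1 / z ^ n - 1 = poly p z / z ^ n"
      using off by eventually_elim (simp add: X1 p_def poly_monom diff_divide_distrib)
    ultimately show "(\<lambda>z. X z $ 1 $ 1 / z ^ n - 1) \<in> O[at_infinity](\<lambda>z. 1 / z)"
      by (simp add: landau_o.big.in_cong)
    \<comment> \<open>The zeroth moment of \<open>g\<close> vanishes, which yields one more power of \<open>1 / z\<close> than the decay
      of a general Cauchy transform.\<close>
    have "(\<lambda>z. 1 / \<kappa> n * (cauchy_transform 1 (\<lambda>s. s * g s) z * (1 / z)))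
            \<in> O[at_infinity](\<lambda>z. 1 / z ^ 2)"
      by (intro landau_o.big.cmult_in_iff[THEN iffD2]
            bigo_mult_eventually_eq[OF cauchy_transform_decay landau_o.big_refl])
         (use polys cont in \<open>auto intro!: continuous_intros simp: power2_eq_square\<close>)
    moreover have "X z $ 1 $ 2 = 1 / \<kappa> n * (cauchy_transform 1 (\<lambda>s. s * g s) z * (1 / z))"
      if "norm z \<noteq> 1 \<and> z \<noteq> 0" for z
    proof -
      have "contour_integral (circlepath 0 1) g = 0"
        unfolding g_def contour_integral_eq_circle_int using moments(1)[of 0 n] n by simp
      then show ?thesis
        using that cauchy_transform_shift[of 1, OF _ cont(1), of z] by (simp add: X12)
    qed
    then have "\<forall>\<^sub>F z in at_infinity.
        X z $ 1 $ 2 = 1 / \<kappa> n * (cauchy_transform 1 (\<lambda>s. s * g s) z * (1 / z))"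
      using off by (rule eventually_mono[rotated])
    ultimately show "(\<lambda>z. X z $ 1 $ 2) \<in> O[at_infinity](\<lambda>z. 1 / z ^ 2)"
      by (simp only: landau_o.big.in_cong)
    show "(\<lambda>z. X z $ 2 $ 1) \<in> O[at_infinity](\<lambda>z. z ^ n)"
      unfolding X1 using poly_bigo_at_infinity[of ?q n] degree_reflect_poly_le[of "\<phi>b n"] polys
      by simp
    \<comment> \<open>The zeroth moment of \<open>h\<close> is \<open>1 / \<kappa> n\<close>, which accounts for the leading term \<open>- 1 / z\<close>.\<close>
    have "(\<lambda>z. - \<kappa> n * cauchy_transform 1 (\<lambda>s. s * h s) z) \<in> O[at_infinity](\<lambda>z. 1 / z)"
      by (intro landau_o.big.cmult_in_iff[THEN iffD2] cauchy_transform_decay)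
         (use polys cont in \<open>auto intro!: continuous_intros\<close>)
    moreover have "- (z * X z $ 2 $ 2) - 1 = - \<kappa> n * cauchy_transform 1 (\<lambda>s. s * h s) z"
      if z: "norm z \<noteq> 1 \<and> z \<noteq> 0" for z
    proof -
      have "circle_int (\<lambda>s. w s * poly ?q s) = circle_int (\<lambda>s. w s * s ^ n * poly (\<phi>b n) (1 / s))"
        by (rule circle_int_cong) (simp add: reflect)
      then have "contour_integral (circlepath 0 1) h = 2 * of_real pi * \<i> * (1 / \<kappa> n)"
        unfolding h_def contour_integral_eq_circle_int moments(3) by simp
      then have "cauchy_transform 1 (\<lambda>s. s * h s) z = 1 / \<kappa> n + z * cauchy_transform 1 h z"
        using z cauchy_transform_shift[of 1, OF _ cont(2), of z] by simp
      then show ?thesis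
        using z polys by (simp add: X22 distrib_left)
    qed
    then have "\<forall>\<^sub>F z in at_infinity.
        - (z * X z $ 2 $ 2) - 1 = - \<kappa> n * cauchy_transform 1 (\<lambda>s. s * h s) z"
      using off by (rule eventually_mono[rotated])
    ultimately show "(\<lambda>z. - (z * X z $ 2 $ 2) - 1) \<in> O[at_infinity](\<lambda>z. 1 / z)"
      by (simp only: landau_o.big.in_cong)
    show "(\<lambda>z. X z $ 1 $ 1) \<in> O[at 0](\<lambda>_. 1)" "(\<lambda>z. X z $ 2 $ 1) \<in> O[at 0](\<lambda>_. 1)"
      unfolding X1
      by (rule holomorphic_bigo_1_at[of _ UNIV]; use polys in \<open>auto intro!: holomorphic_intros\<close>)+
    have C0: "cauchy_transform 1 f \<in> O[at 0](\<lambda>_. 1)" if "continuous_on (sphere 0 1) f" for f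
      by (rule holomorphic_bigo_1_at[OF holC[OF that] openoff]) simp
    have "(\<lambda>z. 1 / \<kappa> n * (z ^ (n - 1) * cauchy_transform 1 g0 z)) \<in> O[at 0](\<lambda>z. z ^ (n - 1))"
      by (intro landau_o.big.cmult_in_iff[THEN iffD2]
            bigo_mult_eventually_eq[OF landau_o.big_refl C0[OF cont(3)]])
         (use polys in auto)
    moreover have "\<forall>\<^sub>F z in at 0. X z $ 1 $ 2 = 1 / \<kappa> n * (z ^ (n - 1) * cauchy_transform 1 g0 z)"
      using off0 by eventually_elim (simp add: X12 g_eq)
    ultimately show "(\<lambda>z. X z $ 1 $ 2) \<in> O[at 0](\<lambda>z. z ^ (n - 1))"
      by (simp only: landau_o.big.in_cong)
    have "(\<lambda>z. \<kappa> n * (z ^ n * cauchy_transform 1 h0 z)) \<in> O[at 0](\<lambda>z. z ^ n)"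
      by (intro landau_o.big.cmult_in_iff[THEN iffD2]
            bigo_mult_eventually_eq[OF landau_o.big_refl C0[OF cont(4)]])
         (use polys in auto)
    moreover have "\<forall>\<^sub>F z in at 0. X z $ 2 $ 2 = \<kappa> n * (z ^ n * cauchy_transform 1 h0 z)"
      using off0 by eventually_elim (simp add: X22 h_eq)
    ultimately show "(\<lambda>z. X z $ 2 $ 2) \<in> O[at 0](\<lambda>z. z ^ n)"
      by (simp only: landau_o.big.in_cong)
  qed
qed

theorem proposition2p8:
  fixes w :: "complex \<Rightarrow> complex" and \<kappa> :: "nat \<Rightarrow> complex"
    and \<phi> \<phi>b :: "nat \<Rightarrow> complex poly" and n :: nat
  assumes "admissible_weight w"
    and "\<And>m. m \<ge> 1 \<Longrightarrow> toeplitz_det w m \<noteq> 0"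
    and "biorthonormal w \<kappa> \<phi> \<phi>b"
    and "n \<ge> 1"
  shows "RH_solution w n (RH_matrix w \<kappa> \<phi> \<phi>b n) \<and>
         (\<forall>Y. RH_solution w n Y \<longrightarrow>
            (\<forall>z. norm z \<noteq> 1 \<longrightarrow> Y z = RH_matrix w \<kappa> \<phi> \<phi>b n z))"
proof -
  obtain r R where "0 < r" "r < 1" "1 < R" "w holomorphic_on {z. r < norm z \<and> norm z < R}"
    using admissible_weight_annulus[OF assms(1)] .
  then have "RH_solution w n (RH_matrix w \<kappa> \<phi> \<phi>b n)"
    using RH_matrix_is_solution[OF assms(3,4)] by blast
  then show ?thesis
    using RH_solution_unique[OF _ _ assms(4)] by blast
qed

end
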